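(* For $m\ge 1$ and any positive integers $l_1,\dots,l_m$, the permutation $D_{l_1}\oplus D_{l_2}\oplus\cdots\oplus D_{l_m}$ is an even thread, and the odd threads entangled with it are the permutations of the form $1\oplus\pi_1\oplus 1\oplus\pi_2\oplus 1\oplus\cdots\oplus 1\oplus\pi_m\oplus 1$, where $\pi_j$ is the complement of a $3412$-avoiding involution of length $l_j-1$ for $1\le j\le m$.
   Context: Permutations are written in one-line notation; $S_n$ is the set of permutations of $\{1,\dots,n\}$, $|\pi|$ is the length of $\pi$, and $1$ denotes the permutation of length one. For $\pi\in S_n$ the complement $c(\pi)\in S_n$ is $c(\pi)(j)=n+1-\pi(j)$. For $\pi\in S_n$, $\sigma\in S_m$, $\pi\oplus\sigma\in S_{n+m}$ has $(\pi\oplus\sigma)(j)=\pi(j)$ for $j\le n$ and $n+\sigma(j-n)$ for $j>n$. $\emptyset$ is the empty permutation (length $0$), an identity for $\oplus$. $@$ is a formal symbol, the "antipermutation", regarded as the unique permutation of length $-1$. $D_n$ is the decreasing permutation $n\cdots 21$. An involution is a permutation equal to its inverse; a permutation avoids $3412$ (classical pattern avoidance) if it has no subsequence with the same relative order as $3412$; $\emptyset$ is a $3412$-avoiding involution. The permutation induced by $\pi$ on a set of its entries is the standardization of the corresponding subsequence. A complete Baxter permutation is a permutation $\pi$ of length $2n+1$ such that $\pi(i)$ is even iff $i$ is even, and whenever $\pi(x)=i$, $\pi(y)=i+1$ and $z$ lies strictly between $x$ and $y$, then $\pi(z)<i$ if $i$ is odd and $\pi(z)>i+1$ if $i$ is even.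 A permutation is alternating if it begins with an ascent and its ascents and descents alternate; it is doubly alternating if it and its inverse are alternating (permutations of length $\le 1$ are doubly alternating). A permutation $\sigma$ of length $n\ge 0$ is a snow leopard permutation if there is a complete Baxter permutation of length $2n+1$ whose even entries induce $\sigma$ and whose odd entries induce a doubly alternating permutation (of length $n+1$). By convention $@$ is also a snow leopard permutation; "odd length" includes length $-1$. Snow leopard permutations preserve parity ($\pi(j)$ is even iff $j$ is even). For a parity-preserving $\pi$, $\pi^e$ and $\pi^o$ are the permutations induced by $\pi$ on its even and odd entries; if $|\pi|=2n+1\ge 1$ then $|\pi^e|=n$, $|\pi^o|=n+1$. By convention $@^e=@$, $@^o=\emptyset$. An even thread (resp. odd thread) is a permutation of the form $\pi^e$ (resp. $\pi^o$) for some snow leopard permutation $\pi$ of odd length. An even thread $\alpha$ and an odd thread $\beta$ are entangled if there is a snow leopard permutation $\pi$ of odd length with $\pi^e=\alpha$ and $\pi^o=\beta$.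
   Formalization: For m=1 it is proved only that D_{l_1} is an even thread and that the permutations of the stated form are odd threads entangled with it; that there are no others is claimed only for m≥2, since for m=1 it is false (D_1 is also entangled with 21, via the snow leopard permutation 321). *)

theory Defs
  imports Main "HOL-Library.Sublist" "HOL-Combinatorics.Multiset_Permutations"
begin

text \<open>Permutations are lists in one-line notation with entries \<open>1,\<dots>,n\<close>.\<close>

definition perms :: "nat \<Rightarrow> nat list set" where
  "perms n = permutations_of_set {1..n}"

text \<open>Positions are numbered from 1.\<close>

definition entry :: "nat list \<Rightarrow> nat \<Rightarrow> nat" where
  "entry \<pi> j = \<pi> ! (j - 1)"

definition perm_inverse :: "nat list \<Rightarrow> nat list" where
  "perm_inverse \<pi> = map (inv_into {1..length \<pi>} (entry \<pi>)) [1..<length \<pi> + 1]"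

definition complement :: "nat list \<Rightarrow> nat list" where
  "complement \<pi> = map (\<lambda>x. length \<pi> + 1 - x) \<pi>"

definition direct_sum :: "nat list \<Rightarrow> nat list \<Rightarrow> nat list" (infixr "\<oplus>\<^sub>p" 65) where
  "\<pi> \<oplus>\<^sub>p \<sigma> = \<pi> @ map (\<lambda>x. length \<pi> + x) \<sigma>"

definition decreasing :: "nat \<Rightarrow> nat list" where
  "decreasing n = rev [1..<n + 1]"

definition standardize :: "nat list \<Rightarrow> nat list" where
  "standardize xs = map (\<lambda>x. card {y \<in> set xs. y \<le> x}) xs"

text \<open>The pattern \<open>\<sigma>\<close> is meant to be a permutation.\<close>

definition avoids :: "nat list \<Rightarrow> nat list \<Rightarrow> bool" where
  "avoids \<sigma> \<pi> \<longleftrightarrow> \<not> (\<exists>xs. subseq xs \<pi> \<and> standardize xs = \<sigma>)"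

definition involution :: "nat list \<Rightarrow> bool" where
  "involution \<pi> \<longleftrightarrow> perm_inverse \<pi> = \<pi>"

definition complete_Baxter :: "nat list \<Rightarrow> bool" where
  "complete_Baxter \<pi> \<longleftrightarrow>
     (\<exists>n. \<pi> \<in> perms (2 * n + 1)) \<and>
     (\<forall>i \<in> {1..length \<pi>}. even (entry \<pi> i) \<longleftrightarrow> even i) \<and>
     (\<forall>x \<in> {1..length \<pi>}. \<forall>y \<in> {1..length \<pi>}. \<forall>z \<in> {1..length \<pi>}. \<forall>i.
        entry \<pi> x = i \<and> entry \<pi> y = i + 1 \<and> (x < z \<and> z < y \<or> y < z \<and> z < x) \<longrightarrow>
        (odd i \<longrightarrow> entry \<pi> z < i) \<and> (even i \<longrightarrow> i + 1 < entry \<pi> z))"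

definition alternating :: "nat list \<Rightarrow> bool" where
  "alternating \<pi> \<longleftrightarrow>
     (\<forall>i \<in> {1..<length \<pi>}.
        (odd i \<longrightarrow> entry \<pi> i < entry \<pi> (i + 1)) \<and>
        (even i \<longrightarrow> entry \<pi> (i + 1) < entry \<pi> i))"

definition doubly_alternating :: "nat list \<Rightarrow> bool" where
  "doubly_alternating \<pi> \<longleftrightarrow> alternating \<pi> \<and> alternating (perm_inverse \<pi>)"

text \<open>\<open>Anti\<close> is the antipermutation, the formal permutation of length \<open>-1\<close>.\<close>

datatype xperm = Anti | Perm "nat list"

fun xlength :: "xperm \<Rightarrow> int" where
  "xlength Anti = -1"
| "xlength (Perm \<pi>) = int (length \<pi>)"

fun snow_leopard :: "xperm \<Rightarrow> bool" where
  "snow_leopard Anti \<longleftrightarrow> True"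
| "snow_leopard (Perm \<sigma>) \<longleftrightarrow>
     \<sigma> \<in> perms (length \<sigma>) \<and>
     (\<exists>\<pi>. length \<pi> = 2 * length \<sigma> + 1 \<and> complete_Baxter \<pi> \<and>
          standardize (filter even \<pi>) = \<sigma> \<and>
          doubly_alternating (standardize (filter odd \<pi>)))"

fun even_part :: "xperm \<Rightarrow> xperm" where
  "even_part Anti = Anti"
| "even_part (Perm \<pi>) = Perm (standardize (filter even \<pi>))"

fun odd_part :: "xperm \<Rightarrow> xperm" where
  "odd_part Anti = Perm []"
| "odd_part (Perm \<pi>) = Perm (standardize (filter odd \<pi>))"

definition even_thread :: "xperm \<Rightarrow> bool" where
  "even_thread \<alpha> \<longleftrightarrow> (\<exists>\<pi>. snow_leopard \<pi> \<and> odd (xlength \<pi>) \<and> \<alpha> = even_part \<pi>)"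

definition odd_thread :: "xperm \<Rightarrow> bool" where
  "odd_thread \<beta> \<longleftrightarrow> (\<exists>\<pi>. snow_leopard \<pi> \<and> odd (xlength \<pi>) \<and> \<beta> = odd_part \<pi>)"

definition entangled :: "xperm \<Rightarrow> xperm \<Rightarrow> bool" where
  "entangled \<alpha> \<beta> \<longleftrightarrow>
     even_thread \<alpha> \<and> odd_thread \<beta> \<and>
     (\<exists>\<pi>. snow_leopard \<pi> \<and> odd (xlength \<pi>) \<and> even_part \<pi> = \<alpha> \<and> odd_part \<pi> = \<beta>)"

definition layered :: "nat list \<Rightarrow> nat list" where
  "layered ls = foldr (\<oplus>\<^sub>p) (map decreasing ls) []"

text \<open>\<open>one_separated [\<pi>\<^sub>1, \<dots>, \<pi>\<^sub>m]\<close> is \<open>1 \<oplus> \<pi>\<^sub>1 \<oplus> 1 \<oplus> \<dots> \<oplus> 1 \<oplus> \<pi>\<^sub>m \<oplus> 1\<close>.\<close>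

fun one_separated :: "nat list list \<Rightarrow> nat list" where
  "one_separated [] = [1]"
| "one_separated (\<pi> # \<pi>s) = [1] \<oplus>\<^sub>p \<pi> \<oplus>\<^sub>p one_separated \<pi>s"

definition co_involution_3412 :: "nat \<Rightarrow> nat list \<Rightarrow> bool" where
  "co_involution_3412 n \<pi> \<longleftrightarrow>
     (\<exists>\<tau> \<in> perms n. involution \<tau> \<and> avoids [3, 4, 1, 2] \<tau> \<and> \<pi> = complement \<tau>)"

definition separated_forms :: "nat list \<Rightarrow> xperm set" where
  "separated_forms ls =
     {Perm (one_separated \<pi>s) | \<pi>s. list_all2 (\<lambda>l \<pi>. co_involution_3412 (l - 1) \<pi>) ls \<pi>s}"


text \<open>
  For a single block the odd threads entangled with \<open>layered [l]\<close> are not exhausted by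
  \<open>separated_forms [l]\<close>: the snow leopard permutation \<open>321\<close>, witnessed by the complete
  Baxter permutation \<open>5674123\<close>, entangles \<open>1 = layered [1]\<close> with \<open>21\<close>, whereas the only
  member of \<open>separated_forms [1]\<close> is \<open>12\<close>. An exact description of the entangled odd
  threads by \<open>separated_forms\<close> therefore needs at least two blocks.
\<close>

lemma card_le_Collect:
  "card {y \<in> set xs. y \<le> (x::nat)} = length (remdups (filter (\<lambda>y. y \<le> x) xs))"
  by (metis List.card_set set_filter)

lemma snow_leopard_321: "snow_leopard (Perm [3, 2, 1])"
proof -
  let ?\<pi> = "[5, 6, 7, 4, 1, 2, 3] :: nat list"
  have seven: "{1..length ?\<pi>} = {1, 2, 3, 4, 5, 6, 7}" by auto
  have "?\<pi> \<in> perms (2 * 3 + 1)"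
    unfolding perms_def by (auto intro!: permutations_of_setI)
  moreover have "complete_Baxter ?\<pi>"
    unfolding complete_Baxter_def
  proof (intro conjI)
    show "\<exists>n. ?\<pi> \<in> perms (2 * n + 1)" using calculation by blast
  qed (simp_all only: seven, simp_all add: entry_def)
  moreover have "standardize (filter even ?\<pi>) = [3, 2, 1]"
    unfolding standardize_def card_le_Collect by simp
  moreover have odds: "standardize (filter odd ?\<pi>) = [3, 4, 1, 2]"
    unfolding standardize_def card_le_Collect by simp
  moreover have "doubly_alternating [3, 4, 1, 2]"
  proof -
    have four: "{1..4::nat} = {1, 2, 3, 4}" "{1..<length [3, 4, 1, 2 :: nat]} = {1, 2, 3}" by auto
    have inj: "inj_on (entry [3, 4, 1, 2]) {1..4}"
      unfolding four by (simp add: entry_def)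
    have inverse: "inv_into {1..4} (entry [3, 4, 1, 2]) i = j"
      if "j \<in> {1..4}" "entry [3, 4, 1, 2] j = i" for i j
      using inv_into_f_f[OF inj that(1)] that(2) by metis
    have "perm_inverse [3, 4, 1, 2] = [3, 4, 1, 2]"
      using inverse[of 3 1] inverse[of 4 2] inverse[of 1 3] inverse[of 2 4]
      by (simp add: perm_inverse_def entry_def upt_rec numeral_eq_Suc)
    then show ?thesis
      unfolding doubly_alternating_def alternating_def by (simp only: four) (simp add: entry_def)
  qed
  moreover have "[3, 2, 1] \<in> perms (length [3, 2, 1 :: nat])"
    unfolding perms_def by (auto intro!: permutations_of_setI)
  ultimately show ?thesis
    by (auto intro!: exI[of _ ?\<pi>])
qed

lemma single_block_not_exhausted:
  "entangled (Perm (layered [1])) (Perm [2, 1])" "Perm [2, 1] \<notin> separated_forms [1]"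
proof -
  have parts: "even_part (Perm [3, 2, 1]) = Perm [1]" "odd_part (Perm [3, 2, 1]) = Perm [2, 1]"
    unfolding even_part.simps odd_part.simps standardize_def card_le_Collect by simp_all
  have "layered [1] = [1]"
    by (simp add: layered_def decreasing_def direct_sum_def)
  moreover have "\<exists>\<pi>. snow_leopard \<pi> \<and> odd (xlength \<pi>) \<and>
      even_part \<pi> = Perm [1] \<and> odd_part \<pi> = Perm [2, 1]"
    using snow_leopard_321 parts by (intro exI[of _ "Perm [3, 2, 1]"]) simp
  ultimately show "entangled (Perm (layered [1])) (Perm [2, 1])"
    unfolding entangled_def even_thread_def odd_thread_def by (metis (no_types))
  show "Perm [2, 1] \<notin> separated_forms [1]"
    by (auto simp: separated_forms_def list_all2_Cons1 direct_sum_def)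
qed

end

theory Submission
  imports Defs
begin

text \<open>
  Write \<open>c\<close> for the complement and \<open>\<ominus>\<close> for the skew sum, in which the first summand lies above the
  second. The proof rests on a grammar for the snow leopard permutations of odd length: they are
  exactly the permutations generated from \<open>1\<close> by \<open>x \<mapsto> 1 \<oplus> c x \<oplus> 1\<close> and \<open>(x, y) \<mapsto> x \<ominus> 1 \<ominus> y\<close>
  (\<open>leopard\<close>, \<open>snow_leopard_iff_leopard\<close>).

  Sorting the entries by parity turns this grammar into one for the entangled pairs of an even and
  an odd thread (\<open>threads\<close>): start from \<open>(\<emptyset>, 1)\<close>, pass from \<open>(\<alpha>, \<beta>)\<close> to
  \<open>(c \<beta>, 1 \<oplus> c \<alpha> \<oplus> 1)\<close>, and from \<open>(\<alpha>, \<beta>)\<close> and \<open>(\<alpha>', \<beta>')\<close> to \<open>(\<alpha> \<ominus> 1 \<ominus> \<alpha>', \<beta> \<ominus> \<beta>')\<close>. Let the even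
  thread be \<open>D\<^bsub>l1\<^esub> \<oplus> \<dots> \<oplus> D\<^bsub>lm\<^esub>\<close> with \<open>m \<ge> 2\<close>. A direct sum is not a skew sum, so the pair comes from
  some \<open>(\<alpha>, \<beta>)\<close> by the second rule, where \<open>\<beta>\<close> is the skew sum of the increasing permutations
  of lengths \<open>l1, \<dots>, lm\<close>. The summands of \<open>\<beta>\<close> split off one at a time by the third rule, and
  \<open>\<alpha>\<close> is correspondingly \<open>\<alpha>1 \<ominus> 1 \<ominus> \<dots> \<ominus> 1 \<ominus> \<alpha>m\<close>, where \<open>\<alpha>j\<close> is entangled with the increasing
  permutation of length \<open>lj\<close>. Complementing \<open>\<alpha>\<close> gives the separators \<open>1\<close> of the theorem, and what is
  left is the case of one monotone thread. Two applications of the second rule send \<open>(D, \<beta>)\<close> to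
  \<open>(D', 1 \<oplus> \<beta> \<oplus> 1)\<close> with \<open>D\<close>, \<open>D'\<close> decreasing, so the odd threads of decreasing even threads are
  generated from \<open>1\<close> by skew sums and by \<open>\<beta> \<mapsto> 1 \<oplus> \<beta> \<oplus> 1\<close>, where \<open>\<beta>\<close> may be empty. Complements of \<open>3412\<close>-avoiding
  involutions are generated in the same way: if such an involution \<open>\<tau>\<close> starts with \<open>k\<close>, then its
  first \<open>k\<close> entries form a permutation that exchanges \<open>1\<close> and \<open>k\<close> (\<open>avoiding_involution_cases\<close>).

  For the grammar itself, let \<open>w\<close> be the complete Baxter permutation of a snow leopard of odd
  length. Since the odd entries of \<open>w\<close> are doubly alternating, an even entry is an ascent, both
  among its neighbours in position and among its neighbours in value, if its position is \<open>2\<close>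
  modulo \<open>4\<close>, and a descent if its position is \<open>0\<close> modulo \<open>4\<close> (\<open>pos_types\<close>, \<open>val_types\<close>,
  \<open>parity_preserving\<close>). Call an interval of positions that \<open>w\<close> maps onto an interval of values a block
  if it arises from single odd entries by joining two blocks across an even entry. Counting
  modulo \<open>4\<close> shows that each block can be joined either to the left or to the right
  (\<open>left_or_right_full\<close>). Each block thus leans on a neighbouring even entry, two blocks that lean on
  the same entry merge, and in the end \<open>w\<close> is a single block (\<open>block_everything\<close>). Reading off
  the joins together with the residues modulo \<open>4\<close> gives the grammar. Conversely, if \<open>v\<close>
  and \<open>w\<close> are witnesses of \<open>x\<close> and \<open>y\<close>, then \<open>12 \<oplus> c v \<oplus> 12\<close> is one of \<open>1 \<oplus> c x \<oplus> 1\<close> and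
  \<open>v \<ominus> 1 \<ominus> w\<close> is one of \<open>x \<ominus> 1 \<ominus> y\<close> (\<open>leopard_witness\<close>).
\<close>

section \<open>Sums and complements of permutations\<close>

definition skew_sum :: "nat list \<Rightarrow> nat list \<Rightarrow> nat list" (infixr "\<ominus>\<^sub>p" 65) where
  "\<pi> \<ominus>\<^sub>p \<sigma> = map (\<lambda>x. length \<sigma> + x) \<pi> @ \<sigma>"

definition is_perm :: "nat list \<Rightarrow> bool" where
  "is_perm \<pi> \<longleftrightarrow> distinct \<pi> \<and> set \<pi> = {1..length \<pi>}"

definition increasing :: "nat \<Rightarrow> nat list" where
  "increasing n = [1..<n + 1]"

lemma perms_iff: "\<pi> \<in> perms n \<longleftrightarrow> is_perm \<pi> \<and> length \<pi> = n"
  unfolding perms_def permutations_of_set_def is_perm_def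
  by (metis (mono_tags, lifting) card_atLeastAtMost diff_Suc_1 distinct_card mem_Collect_eq)

lemma is_perm_bounds: "is_perm \<pi> \<Longrightarrow> v \<in> set \<pi> \<Longrightarrow> 1 \<le> v \<and> v \<le> length \<pi>"
  by (auto simp: is_perm_def)

lemma is_perm_nth_bounds: "is_perm \<pi> \<Longrightarrow> i < length \<pi> \<Longrightarrow> 1 \<le> \<pi> ! i \<and> \<pi> ! i \<le> length \<pi>"
  using is_perm_bounds nth_mem by blast

lemma is_permI:
  assumes "distinct \<pi>" "\<And>v. v \<in> set \<pi> \<Longrightarrow> 1 \<le> v \<and> v \<le> length \<pi>"
  shows "is_perm \<pi>"
proof -
  have "set \<pi> \<subseteq> {1..length \<pi>}" using assms(2) by auto
  then show ?thesis
    using assms(1) by (simp add: is_perm_def card_subset_eq distinct_card)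
qed

lemma is_perm_Nil [simp]: "is_perm []" and is_perm_one [simp]: "is_perm [1]" "is_perm [Suc 0]"
  by (auto simp: is_perm_def)

lemma length_sums [simp]:
  "length (x \<oplus>\<^sub>p y) = length x + length y" "length (x \<ominus>\<^sub>p y) = length x + length y"
  "length (complement x) = length x"
  by (simp_all add: direct_sum_def skew_sum_def complement_def)

lemma is_perm_sum [simp]: "is_perm x \<Longrightarrow> is_perm y \<Longrightarrow> is_perm (x \<oplus>\<^sub>p y)"
  by (rule is_permI) (force simp: direct_sum_def is_perm_def distinct_map inj_on_def)+

lemma is_perm_skew [simp]: "is_perm x \<Longrightarrow> is_perm y \<Longrightarrow> is_perm (x \<ominus>\<^sub>p y)"
  by (rule is_permI) (force simp: skew_sum_def is_perm_def distinct_map inj_on_def)+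

lemma is_perm_complement [simp]: "is_perm x \<Longrightarrow> is_perm (complement x)"
  by (rule is_permI) (auto simp: complement_def is_perm_def distinct_map inj_on_def)

lemma is_perm_increasing [simp]: "is_perm (increasing n)"
  by (rule is_permI) (auto simp: increasing_def)

lemma is_perm_decreasing [simp]: "is_perm (decreasing n)"
  by (rule is_permI) (auto simp: decreasing_def)

lemma length_increasing_decreasing [simp]: "length (increasing n) = n" "length (decreasing n) = n"
  by (auto simp: increasing_def decreasing_def)

lemma sum_assoc [simp]: "(x \<oplus>\<^sub>p y) \<oplus>\<^sub>p z = x \<oplus>\<^sub>p y \<oplus>\<^sub>p z"
  by (simp add: direct_sum_def)

lemma skew_assoc [simp]: "(x \<ominus>\<^sub>p y) \<ominus>\<^sub>p z = x \<ominus>\<^sub>p y \<ominus>\<^sub>p z"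
  by (simp add: skew_sum_def)

lemma sum_Nil [simp]: "[] \<oplus>\<^sub>p x = x" "x \<oplus>\<^sub>p [] = x" "[] \<ominus>\<^sub>p x = x" "x \<ominus>\<^sub>p [] = x"
  by (simp_all add: direct_sum_def skew_sum_def)

lemma sum_eq_Nil [simp]: "x \<oplus>\<^sub>p y = [] \<longleftrightarrow> x = [] \<and> y = []" "x \<ominus>\<^sub>p y = [] \<longleftrightarrow> x = [] \<and> y = []"
  "complement x = [] \<longleftrightarrow> x = []"
  by (auto simp: direct_sum_def skew_sum_def complement_def)

lemma complement_complement [simp]: "is_perm x \<Longrightarrow> complement (complement x) = x"
  by (auto simp: complement_def is_perm_def intro!: map_idI)

lemma complement_sum: "is_perm x \<Longrightarrow> is_perm y \<Longrightarrow> complement (x \<oplus>\<^sub>p y) = complement x \<ominus>\<^sub>p complement y"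
  by (auto simp: complement_def direct_sum_def skew_sum_def is_perm_def)

lemma complement_skew: "is_perm x \<Longrightarrow> is_perm y \<Longrightarrow> complement (x \<ominus>\<^sub>p y) = complement x \<oplus>\<^sub>p complement y"
  by (metis complement_complement complement_sum is_perm_complement is_perm_sum)

lemma complement_small [simp]: "complement [] = []" "complement [1] = [1]" "complement [Suc 0] = [Suc 0]"
  by (simp_all add: complement_def)

lemma complement_increasing [simp]: "complement (increasing n) = decreasing n"
  by (rule nth_equalityI) (auto simp: complement_def increasing_def decreasing_def rev_nth simp del: upt_Suc)

lemma complement_decreasing [simp]: "complement (decreasing n) = increasing n"
  by (metis complement_complement complement_increasing is_perm_increasing)

lemma complement_eq_iff: "is_perm x \<Longrightarrow> is_perm y \<Longrightarrow> complement x = y \<longleftrightarrow> x = complement y"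
  by auto

lemma sum_nth:
  "i < length x + length y \<Longrightarrow>
     (x \<oplus>\<^sub>p y) ! i = (if i < length x then x ! i else length x + y ! (i - length x))"
  by (auto simp: direct_sum_def nth_append)

lemma skew_nth:
  "i < length x + length y \<Longrightarrow>
     (x \<ominus>\<^sub>p y) ! i = (if i < length x then length y + x ! i else y ! (i - length x))"
  by (auto simp: skew_sum_def nth_append)

lemma complement_nth: "i < length x \<Longrightarrow> complement x ! i = length x + 1 - x ! i"
  by (simp add: complement_def)

lemma sum_left_cancel: "length x = length x' \<Longrightarrow> x \<oplus>\<^sub>p y = x' \<oplus>\<^sub>p y' \<longleftrightarrow> x = x' \<and> y = y'"
  by (auto simp: direct_sum_def inj_on_def inj_map_eq_map)

lemma increasing_add: "increasing (m + n) = increasing m \<oplus>\<^sub>p increasing n"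
  by (rule nth_equalityI) (auto simp: increasing_def sum_nth simp del: upt_Suc)

lemma increasing_1: "increasing 1 = [1]" "increasing (Suc 0) = [1]" "increasing 0 = []"
  by (simp_all add: increasing_def)

lemma decreasing_1: "decreasing (Suc 0) = [1]" "decreasing 0 = []"
  by (simp_all add: decreasing_def)

lemma sum_eq_increasing_iff:
  "x \<oplus>\<^sub>p y = increasing n \<longleftrightarrow>
     n = length x + length y \<and> x = increasing (length x) \<and> y = increasing (length y)"
proof
  assume eq: "x \<oplus>\<^sub>p y = increasing n"
  then have n: "n = length x + length y" by (metis length_sums(1) length_increasing_decreasing(1))
  show "n = length x + length y \<and> x = increasing (length x) \<and> y = increasing (length y)"
    using eq unfolding n by (simp add: increasing_add sum_left_cancel)
qed (metis increasing_add)

lemma skew_eq_decreasing_iff: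
  assumes "is_perm x" "is_perm y"
  shows "x \<ominus>\<^sub>p y = decreasing n \<longleftrightarrow>
     n = length x + length y \<and> x = decreasing (length x) \<and> y = decreasing (length y)"
proof -
  have "x \<ominus>\<^sub>p y = decreasing n \<longleftrightarrow> complement x \<oplus>\<^sub>p complement y = increasing n"
    using assms by (metis complement_increasing complement_decreasing complement_skew complement_sum
        complement_complement is_perm_complement)
  then show ?thesis
    using assms by (simp add: sum_eq_increasing_iff complement_eq_iff)
qed

text \<open>
  Compare the initial parts \<open>x\<close> and \<open>u\<close>. If \<open>x\<close> is the shorter one, the value \<open>1\<close> sits inside \<open>u\<close>,
  which carries only large values; otherwise the largest value sits inside \<open>x\<close>, which carries
  only small ones.
\<close>
lemma sum_neq_skew:
  assumes "is_perm x" "is_perm y" "is_perm u" "is_perm v" "x \<noteq> []" "y \<noteq> []" "u \<noteq> []" "v \<noteq> []"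
  shows "x \<oplus>\<^sub>p y \<noteq> u \<ominus>\<^sub>p v"
proof
  assume eq: "x \<oplus>\<^sub>p y = u \<ominus>\<^sub>p v"
  have len: "length x + length y = length u + length v"
    using arg_cong[OF eq, of length] by simp
  show False
  proof (cases "length x \<le> length u")
    case True
    have "1 \<in> set x" using assms by (cases x) (auto simp: is_perm_def)
    then obtain i where i: "i < length x" "x ! i = 1" by (auto simp: in_set_conv_nth)
    have "(x \<oplus>\<^sub>p y) ! i = 1" "(u \<ominus>\<^sub>p v) ! i > 1"
      using i True is_perm_nth_bounds[OF assms(3), of i] assms(8)
      by (auto simp: sum_nth skew_nth len) (cases v; simp)
    then show False using eq by simp
  next
    case False
    then have l: "length u < length x" by simp
    have "length u \<in> set u" using assms by (cases u) (auto simp: is_perm_def)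
    then obtain i where i: "i < length u" "u ! i = length u" by (auto simp: in_set_conv_nth)
    have "(u \<ominus>\<^sub>p v) ! i = length x + length y" "(x \<oplus>\<^sub>p y) ! i \<le> length x"
      using i l is_perm_nth_bounds[OF assms(1), of i] by (auto simp: sum_nth skew_nth len)
    then show False using eq assms(6) by simp
  qed
qed

lemma initial_block:
  assumes "is_perm \<tau>" "k \<le> length \<tau>" "\<And>i. i < k \<Longrightarrow> \<tau> ! i \<le> k"
  obtains x y where "is_perm x" "is_perm y" "length x = k" "\<tau> = x \<oplus>\<^sub>p y"
proof -
  have d: "distinct (take k \<tau> @ drop k \<tau>)" and s: "set (take k \<tau> @ drop k \<tau>) = {1..length \<tau>}"
    using assms(1) by (auto simp: is_perm_def)
  have x: "is_perm (take k \<tau>)"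
    using assms is_perm_nth_bounds[OF assms(1)] by (intro is_permI) (auto simp: is_perm_def in_set_conv_nth)
  have "set (take k \<tau>) = {1..k}" using x assms(2) by (simp add: is_perm_def)
  then have high: "k < v \<and> v \<le> length \<tau>" if "v \<in> set (drop k \<tau>)" for v
  proof -
    have "v \<in> {1..length \<tau>}" "v \<notin> set (take k \<tau>)"
      using that d s unfolding set_append distinct_append by blast+
    then show ?thesis using \<open>set (take k \<tau>) = {1..k}\<close> by auto
  qed
  have y: "is_perm (map (\<lambda>v. v - k) (drop k \<tau>))"
  proof (rule is_permI)
    show "distinct (map (\<lambda>v. v - k) (drop k \<tau>))"
      using d high by (auto simp: distinct_map inj_on_def) (metis eq_diff_iff less_imp_le)
  qed (use high in force)
  have "\<tau> = take k \<tau> \<oplus>\<^sub>p map (\<lambda>v. v - k) (drop k \<tau>)"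
  proof -
    have "map ((+) k) (map (\<lambda>v. v - k) (drop k \<tau>)) = drop k \<tau>"
      unfolding map_map by (rule map_idI) (use high in fastforce)
    then show ?thesis using assms(2) by (simp add: direct_sum_def min_def)
  qed
  then show thesis using that x y assms(2) by (metis length_take min.absorb2)
qed

lemma initial_block_skew:
  assumes "is_perm \<tau>" "k \<le> length \<tau>" "\<And>i. i < k \<Longrightarrow> length \<tau> - k < \<tau> ! i"
  obtains x y where "is_perm x" "is_perm y" "length x = k" "\<tau> = x \<ominus>\<^sub>p y"
proof -
  have "complement \<tau> ! i \<le> k" if "i < k" for i
    using assms(2) assms(3)[OF that] that by (simp add: complement_nth)
  then obtain x y where "is_perm x" "is_perm y" "length x = k" "complement \<tau> = x \<oplus>\<^sub>p y"
    using initial_block[of "complement \<tau>" k] assms(1,2) by auto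
  then show thesis using that[of "complement x" "complement y"] assms(1) by (metis complement_complement
        complement_sum is_perm_complement length_sums(3))
qed

lemma is_perm_length_1: "is_perm x \<Longrightarrow> length x = 1 \<Longrightarrow> x = [1]"
  by (cases x) (auto simp: is_perm_def)

section \<open>Ascents and descents of a complete Baxter permutation\<close>

text \<open>
  This finds the consecutive values that lie on different sides of a given position.
\<close>
lemma crossing:
  fixes P :: "nat \<Rightarrow> bool"
  assumes "P lo" "\<not> P hi" "lo \<le> hi"
  shows "\<exists>v. lo \<le> v \<and> v < hi \<and> P v \<and> \<not> P (v + 1)"
proof (rule ccontr)
  assume "\<not> ?thesis"
  then have step: "lo \<le> v \<Longrightarrow> v < hi \<Longrightarrow> P v \<Longrightarrow> P (Suc v)" for v by auto
  have "P hi" using assms(3,1) step by (induction rule: dec_induct) auto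
  then show False using assms(2) by simp
qed

text \<open>
  A complete Baxter permutation \<open>w\<close> of \<open>{1..2n+1}\<close> with inverse \<open>q\<close>, written as functions. The last
  two assumptions say that the permutation induced on the odd entries is doubly alternating. Oddness
  of \<open>n\<close> makes the two virtual even positions \<open>0\<close> and \<open>2n+2\<close> beside \<open>w\<close> congruent modulo \<open>4\<close>.
\<close>
locale alternating_Baxter =
  fixes n :: nat and w q :: "nat \<Rightarrow> nat"
  assumes odd_n: "odd n"
    and w_range: "\<And>j. j \<in> {1..2*n+1} \<Longrightarrow> w j \<in> {1..2*n+1}"
    and q_range: "\<And>v. v \<in> {1..2*n+1} \<Longrightarrow> q v \<in> {1..2*n+1}"
    and qw: "\<And>j. j \<in> {1..2*n+1} \<Longrightarrow> q (w j) = j"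
    and wq: "\<And>v. v \<in> {1..2*n+1} \<Longrightarrow> w (q v) = v"
    and parity: "\<And>j. j \<in> {1..2*n+1} \<Longrightarrow> even (w j) \<longleftrightarrow> even j"
    and between: "\<And>i z. \<lbrakk>1 \<le> i; i \<le> 2*n; q i < z \<and> z < q (i + 1) \<or> q (i + 1) < z \<and> z < q i\<rbrakk>
        \<Longrightarrow> (odd i \<longrightarrow> w z < i) \<and> (even i \<longrightarrow> i + 1 < w z)"
    and alt_pos: "\<And>i. \<lbrakk>1 \<le> i; i \<le> n\<rbrakk> \<Longrightarrow>
        (odd i \<longrightarrow> w (2*i-1) < w (2*i+1)) \<and> (even i \<longrightarrow> w (2*i+1) < w (2*i-1))"
    and alt_val: "\<And>i. \<lbrakk>1 \<le> i; i \<le> n\<rbrakk> \<Longrightarrow>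
        (odd i \<longrightarrow> q (2*i-1) < q (2*i+1)) \<and> (even i \<longrightarrow> q (2*i+1) < q (2*i-1))"
begin

lemma q_parity: "v \<in> {1..2*n+1} \<Longrightarrow> even (q v) \<longleftrightarrow> even v"
  using parity q_range wq by metis

text \<open>
  The Baxter condition speaks about entries of consecutive values. The next four lemmas transfer
  it to consecutive positions \<open>p - 1, p\<close> and \<open>p, p + 1\<close> around an even \<open>p\<close>: the values strictly
  between two such entries lie to the left of \<open>p - 1\<close>, or to the right of \<open>p + 1\<close>. If one of
  them lay on the wrong side, some two consecutive values would lie on opposite sides of \<open>p\<close>. The
  Baxter condition for these two, applied to the entry at \<open>p\<close>, determines their parities; applied to
  the entry at \<open>p - 1\<close> or \<open>p + 1\<close>, it forces one of them into that odd position although it is even.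
\<close>
lemma before_up:
  assumes p: "even p" "1 \<le> p" "p \<le> 2*n" and u: "w (p - 1) < u" "u < w p"
  shows "q u < p - 1"
proof (rule ccontr)
  assume neg: "\<not> q u < p - 1"
  have r: "p \<in> {1..2*n+1}" "p - 1 \<in> {1..2*n+1}" using p by (auto elim!: evenE)
  have ur: "u \<in> {1..2*n+1}" using u w_range[OF r(1)] by auto
  have "q u \<noteq> p - 1" using u wq[OF ur] by auto
  then obtain v where v: "w (p - 1) \<le> v" "v < u" "q v \<le> p - 1" "\<not> q (v + 1) \<le> p - 1"
    using crossing[of "\<lambda>v. q v \<le> p - 1" "w (p - 1)" u] neg u qw[OF r(2)] by auto
  have vr: "v \<in> {1..2*n+1}" "v + 1 \<in> {1..2*n+1}" using v w_range[OF r(2)] ur by auto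
  have "q (v + 1) \<noteq> p" using wq[OF vr(2)] v u by auto
  then have "q v < p" "p < q (v + 1)" using v p by auto
  then have ev: "even v" using between[of v p] v u vr by auto
  have "q v = p - 1" using between[of v "p - 1"] ev v vr p by force
  then show False using ev p q_parity[OF vr(1)] by auto
qed

lemma before_down:
  assumes p: "even p" "1 \<le> p" "p \<le> 2*n" and u: "w p < u" "u < w (p - 1)"
  shows "q u < p - 1"
proof (rule ccontr)
  assume neg: "\<not> q u < p - 1"
  have r: "p \<in> {1..2*n+1}" "p - 1 \<in> {1..2*n+1}" using p by (auto elim!: evenE)
  have ur: "u \<in> {1..2*n+1}" using u w_range[OF r(2)] by auto
  have "q u \<noteq> p - 1" using u wq[OF ur] by auto
  then obtain v where v: "u \<le> v" "v < w (p - 1)" "p \<le> q v" "\<not> p \<le> q (v + 1)"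
    using crossing[of "\<lambda>v. p \<le> q v" u "w (p - 1)"] neg u qw[OF r(2)] p by fastforce
  have vr: "v \<in> {1..2*n+1}" "v + 1 \<in> {1..2*n+1}" using v w_range[OF r(2)] ur by auto
  have "q v \<noteq> p" using wq[OF vr(1)] v u by auto
  then have "p < q v" "q (v + 1) < p" using v p by auto
  then have ev: "odd v" using between[of v p] v u vr by auto
  have "q (v + 1) = p - 1" using between[of v "p - 1"] ev v vr p by force
  then show False using ev p q_parity[OF vr(2)] by auto
qed

lemma after_up:
  assumes p: "even p" "1 \<le> p" "p \<le> 2*n" and u: "w p < u" "u < w (p + 1)"
  shows "p + 1 < q u"
proof (rule ccontr)
  assume neg: "\<not> p + 1 < q u"
  have r: "p \<in> {1..2*n+1}" "p + 1 \<in> {1..2*n+1}" using p by (auto elim!: evenE)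
  have ur: "u \<in> {1..2*n+1}" using u w_range[OF r(2)] by auto
  have "q u \<noteq> p + 1" using u wq[OF ur] by auto
  then obtain v where v: "u \<le> v" "v < w (p + 1)" "q v \<le> p" "\<not> q (v + 1) \<le> p"
    using crossing[of "\<lambda>v. q v \<le> p" u "w (p + 1)"] neg u qw[OF r(2)] by auto
  have vr: "v \<in> {1..2*n+1}" "v + 1 \<in> {1..2*n+1}" using v w_range[OF r(2)] ur by auto
  have "q v \<noteq> p" using wq[OF vr(1)] v u by auto
  then have "q v < p" "p < q (v + 1)" using v p by auto
  then have ev: "odd v" using between[of v p] v u vr by auto
  have "q (v + 1) = p + 1" using between[of v "p + 1"] ev v vr p by force
  then show False using ev p q_parity[OF vr(2)] by auto
qed

lemma after_down:
  assumes p: "even p" "1 \<le> p" "p \<le> 2*n" and u: "w (p + 1) < u" "u < w p"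
  shows "p + 1 < q u"
proof (rule ccontr)
  assume neg: "\<not> p + 1 < q u"
  have r: "p \<in> {1..2*n+1}" "p + 1 \<in> {1..2*n+1}" using p by (auto elim!: evenE)
  have ur: "u \<in> {1..2*n+1}" using u w_range[OF r(1)] by auto
  have "q u \<noteq> p + 1" using u wq[OF ur] by auto
  then obtain v where v: "w (p + 1) \<le> v" "v < u" "p + 1 \<le> q v" "\<not> p + 1 \<le> q (v + 1)"
    using crossing[of "\<lambda>v. p + 1 \<le> q v" "w (p + 1)" u] neg u qw[OF r(2)] p by auto
  have vr: "v \<in> {1..2*n+1}" "v + 1 \<in> {1..2*n+1}" using v w_range[OF r(2)] ur by auto
  have "q (v + 1) \<noteq> p" using wq[OF vr(2)] v u by auto
  then have "p < q v" "q (v + 1) < p" using v p by auto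
  then have ev: "even v" using between[of v p] v u vr by auto
  have "q v = p + 1" using between[of v "p + 1"] ev v vr p by force
  then show False using ev p q_parity[OF vr(1)] by auto
qed

text \<open>
  The alternation of the odd entries fixes the order of the two neighbours of an even position, and
  the entry itself has to lie between them: otherwise one neighbour would lie in value between the
  entry and the other neighbour, on the side that is excluded.
\<close>
lemma pos_types:
  assumes "1 \<le> i" "i \<le> n"
  shows "odd i \<Longrightarrow> w (2*i-1) < w (2*i) \<and> w (2*i) < w (2*i+1)"
    and "even i \<Longrightarrow> w (2*i+1) < w (2*i) \<and> w (2*i) < w (2*i-1)"
proof -
  have r: "2*i-1 \<in> {1..2*n+1}" "2*i \<in> {1..2*n+1}" "2*i+1 \<in> {1..2*n+1}" using assms by auto
  have p: "even (2*i)" "1 \<le> 2*i" "2*i \<le> 2*n" using assms by auto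
  note d = parity[OF r(1)] parity[OF r(2)] parity[OF r(3)] qw[OF r(1)] qw[OF r(3)]
  have ne: "w (2*i) \<noteq> w (2*i-1)" "w (2*i) \<noteq> w (2*i+1)" using d assms by auto
  show "odd i \<Longrightarrow> w (2*i-1) < w (2*i) \<and> w (2*i) < w (2*i+1)"
    using alt_pos[OF assms] ne before_up[OF p, of "w (2*i+1)"] after_up[OF p, of "w (2*i-1)"] d by force
  show "even i \<Longrightarrow> w (2*i+1) < w (2*i) \<and> w (2*i) < w (2*i-1)"
    using alt_pos[OF assms] ne before_down[OF p, of "w (2*i+1)"] after_down[OF p, of "w (2*i-1)"] d by force
qed

lemma val_types:
  assumes "1 \<le> i" "i \<le> n"
  shows "odd i \<Longrightarrow> q (2*i-1) < q (2*i) \<and> q (2*i) < q (2*i+1)"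
    and "even i \<Longrightarrow> q (2*i+1) < q (2*i) \<and> q (2*i) < q (2*i-1)"
proof -
  have r: "2*i-1 \<in> {1..2*n+1}" "2*i \<in> {1..2*n+1}" "2*i+1 \<in> {1..2*n+1}" using assms by auto
  note d = q_parity[OF r(1)] q_parity[OF r(2)] q_parity[OF r(3)] wq[OF r(1)] wq[OF r(2)] wq[OF r(3)]
  have ne: "q (2*i) \<noteq> q (2*i-1)" "q (2*i) \<noteq> q (2*i+1)" using d assms by auto
  have i1: "1 \<le> 2*i-1" "2*i-1 \<le> 2*n" using assms by auto
  have b1: "\<not> (q (2*i-1) < q (2*i+1) \<and> q (2*i+1) < q (2*i))"
    "\<not> (q (2*i) < q (2*i+1) \<and> q (2*i+1) < q (2*i-1))"
    using between[of "2*i-1" "q (2*i+1)", OF i1] assms d by auto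
  have b2: "\<not> (q (2*i) < q (2*i-1) \<and> q (2*i-1) < q (2*i+1))"
    "\<not> (q (2*i+1) < q (2*i-1) \<and> q (2*i-1) < q (2*i))"
    using between[of "2*i" "q (2*i-1)"] assms d by auto
  show "odd i \<Longrightarrow> q (2*i-1) < q (2*i) \<and> q (2*i) < q (2*i+1)"
    using alt_val[OF assms] ne b1 b2 by linarith
  show "even i \<Longrightarrow> q (2*i+1) < q (2*i) \<and> q (2*i) < q (2*i-1)"
    using alt_val[OF assms] ne b1 b2 by linarith
qed

text \<open>
  If the position and the value of an even entry disagreed about its type, then a neighbouring
  value would lie to the right of the entry, while lying between the entry and its predecessor.
\<close>
lemma parity_preserving:
  assumes "1 \<le> i" "i \<le> n" "w (2*i) = 2*s"
  shows "even s \<longleftrightarrow> even i"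
proof -
  have r: "2*i-1 \<in> {1..2*n+1}" "2*i \<in> {1..2*n+1}" "2*i+1 \<in> {1..2*n+1}" using assms by auto
  have s: "1 \<le> s" "s \<le> n" using w_range[OF r(2)] assms by auto
  have p: "even (2*i)" "1 \<le> 2*i" "2*i \<le> 2*n" using assms by auto
  have qs: "q (2*s) = 2*i" using qw[OF r(2)] assms by simp
  have rs: "2*s-1 \<in> {1..2*n+1}" "2*s+1 \<in> {1..2*n+1}" using s by auto
  note d = qw[OF r(1)] qw[OF r(3)]
  have up: "even s \<Longrightarrow> odd i \<Longrightarrow> False"
  proof -
    assume "even s" "odd i"
    then have *: "w (2*i-1) < 2*s" "2*i < q (2*s-1)"
      using pos_types(1)[OF assms(1,2)] val_types(2)[OF s] assms(3) qs by auto
    moreover have "w (2*i-1) \<noteq> 2*s-1" using d * by auto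
    ultimately show False using before_up[OF p, of "2*s-1"] assms(3) by force
  qed
  have down: "odd s \<Longrightarrow> even i \<Longrightarrow> False"
  proof -
    assume "odd s" "even i"
    then have *: "2*s < w (2*i-1)" "2*i < q (2*s+1)"
      using pos_types(2)[OF assms(1,2)] val_types(1)[OF s] assms(3) qs by auto
    moreover have "w (2*i-1) \<noteq> 2*s+1" using d * by auto
    ultimately show False using before_down[OF p, of "2*s+1"] assms(3) by force
  qed
  show ?thesis using up down by blast
qed

end

section \<open>Blocks\<close>

context alternating_Baxter
begin

text \<open>
  \<open>block a b xs\<close> says that the positions \<open>2a+1, \<dots>, 2(a+m)+1\<close> carry the values \<open>2b+1, \<dots>, 2(b+m)+1\<close>,
  where \<open>m\<close> is the length of \<open>xs\<close>, that the even entries among them induce \<open>xs\<close>, and that this piece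
  of \<open>w\<close> can be taken apart completely by cutting at even entries. An ascending cut is made at an
  ascent, that is at a position \<open>2i\<close> with odd \<open>i\<close>, and a descending one at a descent.
\<close>
inductive block :: "nat \<Rightarrow> nat \<Rightarrow> nat list \<Rightarrow> bool" where
  leaf: "a \<le> n \<Longrightarrow> w (2*a+1) = 2*b+1 \<Longrightarrow> block a b []"
| ascent: "block a b xs \<Longrightarrow> block (a + length xs + 1) (b + length xs + 1) ys \<Longrightarrow>
     odd (a + length xs + 1) \<Longrightarrow> w (2 * (a + length xs + 1)) = 2 * (b + length xs + 1) \<Longrightarrow> block a b (xs \<oplus>\<^sub>p [1] \<oplus>\<^sub>p ys)"
| descent: "block a (b + length ys + 1) xs \<Longrightarrow> block (a + length xs + 1) b ys \<Longrightarrow>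
     even (a + length xs + 1) \<Longrightarrow> w (2 * (a + length xs + 1)) = 2 * (b + length ys + 1) \<Longrightarrow> block a b (xs \<ominus>\<^sub>p [1] \<ominus>\<^sub>p ys)"

lemma block_fits: "block a b xs \<Longrightarrow> a + length xs \<le> n \<and> b + length xs \<le> n \<and> is_perm xs"
proof (induction rule: block.induct)
  case (leaf a b)
  then show ?case using w_range[of "2*a+1"] by auto
qed auto

lemma block_w:
  "block a b xs \<Longrightarrow> 2*a+1 \<le> j \<Longrightarrow> j \<le> 2*(a + length xs)+1 \<Longrightarrow>
     2*b+1 \<le> w j \<and> w j \<le> 2*(b + length xs)+1"
proof (induction arbitrary: j rule: block.induct)
  case (leaf a b)
  then have "j = 2*a+1" by simp
  then show ?case using leaf by simp
next
  case (ascent a b xs ys)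
  consider "j \<le> 2*(a + length xs)+1" | "j = 2 * (a + length xs + 1)" | "2 * (a + length xs + 1) + 1 \<le> j"
    by atomize_elim arith
  then show ?case
    using ascent.IH[of j] ascent.hyps(4) ascent.prems by cases auto
next
  case (descent a b ys xs)
  consider "j \<le> 2*(a + length xs)+1" | "j = 2 * (a + length xs + 1)" | "2 * (a + length xs + 1) + 1 \<le> j"
    by atomize_elim arith
  then show ?case
    using descent.IH[of j] descent.hyps(4) descent.prems by cases auto
qed

lemma block_q:
  "block a b xs \<Longrightarrow> 2*b+1 \<le> v \<Longrightarrow> v \<le> 2*(b + length xs)+1 \<Longrightarrow>
     2*a+1 \<le> q v \<and> q v \<le> 2*(a + length xs)+1"
proof (induction arbitrary: v rule: block.induct)
  case (leaf a b)
  then have "v = w (2*a+1)" by simp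
  then show ?case using leaf qw[of "2*a+1"] by simp
next
  case (ascent a b xs ys)
  have mid: "q (2 * (b + length xs + 1)) = 2 * (a + length xs + 1)"
    using qw[of "2 * (a + length xs + 1)"] block_fits[OF ascent.hyps(2)] ascent.hyps(4) by simp
  consider "v \<le> 2*(b + length xs)+1" | "v = 2 * (b + length xs + 1)" | "2 * (b + length xs + 1) + 1 \<le> v"
    by atomize_elim arith
  then show ?case
    using ascent.IH[of v] ascent.prems mid by cases auto
next
  case (descent a b ys xs)
  have mid: "q (2 * (b + length ys + 1)) = 2 * (a + length xs + 1)"
    using qw[of "2 * (a + length xs + 1)"] block_fits[OF descent.hyps(2)] descent.hyps(4) by simp
  consider "v \<le> 2*(b + length ys)+1" | "v = 2 * (b + length ys + 1)" | "2 * (b + length ys + 1) + 1 \<le> v"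
    by atomize_elim arith
  then show ?case
    using descent.IH[of v] descent.prems mid by cases auto
qed

lemma block_entries: "block a b xs \<Longrightarrow> i < length xs \<Longrightarrow> w (2 * (a + i + 1)) = 2 * (b + xs ! i)"
proof (induction arbitrary: i rule: block.induct)
  case (ascent a b xs ys)
  consider "i < length xs" | "i = length xs" | k where "i = length xs + 1 + k" "k < length ys"
    using ascent.prems le_Suc_ex[of "length xs + 1" i] by force
  then show ?case
  proof cases
    case 3
    then have "w (2 * (a + i + 1)) = 2 * (b + length xs + 1 + ys ! k)"
      using ascent.IH(2)[of k] by (simp add: ac_simps)
    then show ?thesis using 3 by (simp add: sum_nth)
  qed (use ascent.IH(1)[of i] ascent.hyps(4) in \<open>simp_all add: sum_nth\<close>)
next
  case (descent a b ys xs)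
  consider "i < length xs" | "i = length xs" | k where "i = length xs + 1 + k" "k < length ys"
    using descent.prems le_Suc_ex[of "length xs + 1" i] by force
  then show ?case
  proof cases
    case 3
    then have "w (2 * (a + i + 1)) = 2 * (b + ys ! k)"
      using descent.IH(2)[of k] by (simp add: ac_simps)
    then show ?thesis using 3 by (simp add: skew_nth)
  qed (use descent.IH(1)[of i] descent.hyps(4) in \<open>simp_all add: skew_nth\<close>)
qed simp

text \<open>
  The entry at which a block is cut has the same parity, after halving, in position and in value.
  This excludes blocks whose four neighbours are alternately ascents and descents as one goes
  around, as at the centre of a pinwheel; such a block could not be joined in any direction.
\<close>
lemma block_parity: "block a b xs \<Longrightarrow> even (length xs) \<or> (even a \<longleftrightarrow> even b)"
proof (induction rule: block.induct)
  case (ascent a b xs ys)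
  then show ?case
    using parity_preserving[OF _ _ ascent.hyps(4)] block_fits[OF ascent.hyps(2)] by auto
next
  case (descent a b ys xs)
  then show ?case
    using parity_preserving[OF _ _ descent.hyps(4)] block_fits[OF descent.hyps(2)] by auto
qed simp

text \<open>
  A block has a left and a right neighbour in position, at \<open>2a\<close> and \<open>2(a+m+1)\<close>, and a lower and an
  upper neighbour in value, \<open>2b\<close> and \<open>2(b+m+1)\<close>. The even entry of position or value \<open>2i\<close> is an ascent
  if \<open>i\<close> is odd and a descent if \<open>i\<close> is even; the ends \<open>0\<close> and \<open>2n+2\<close> count as descents. A block is
  left full if the left and the lower neighbour are ascents or the left and the upper neighbour are
  descents. Then these two neighbours are one and the same entry (\<open>left_full_neighbour\<close>).
\<close>
definition left_full :: "nat \<Rightarrow> nat \<Rightarrow> nat \<Rightarrow> bool" where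
  "left_full a b m \<longleftrightarrow> odd a \<and> odd b \<or> even a \<and> even (b + m + 1)"

definition right_full :: "nat \<Rightarrow> nat \<Rightarrow> nat \<Rightarrow> bool" where
  "right_full a b m \<longleftrightarrow> odd (a + m + 1) \<and> odd (b + m + 1) \<or> even (a + m + 1) \<and> even b"

lemma left_or_right_full: "block a b xs \<Longrightarrow> left_full a b (length xs) \<or> right_full a b (length xs)"
  using block_parity[of a b xs] by (auto simp: left_full_def right_full_def)

text \<open>
  In the ascending case the entry to the right lies above the block, and so does the value \<open>2(b+m+1)\<close>,
  to the right of the block. If they differed, this value would lie between the last
  entry of the block and its right neighbour, and therefore to the left of the block. The descending
  case is symmetric.
\<close>
lemma right_full_neighbour:
  assumes B: "block a b xs" and m: "m = length xs" and full: "right_full a b m" and r: "a + m + 1 \<le> n"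
  shows "odd (a + m + 1) \<and> w (2 * (a + m + 1)) = 2 * (b + m + 1) \<or>
         even (a + m + 1) \<and> w (2 * (a + m + 1)) = 2 * b"
proof -
  define i where "i = a + m + 1"
  have i: "1 \<le> i" "i \<le> n" and i1: "2*i - 1 = 2*(a+m)+1" using r by (auto simp: i_def)
  have p: "even (2*i)" "1 \<le> 2*i" "2*i \<le> 2*n" and ir: "2*i \<in> {1..2*n+1}" using i by auto
  note wi = block_w[OF B, of "2*i-1", folded m]
  have win: "2*b+1 \<le> w (2*i-1)" "w (2*i-1) \<le> 2*(b+m)+1" using wi i1 by auto
  have out: "\<not> (2*b+1 \<le> w (2*i) \<and> w (2*i) \<le> 2*(b+m)+1)"
    using block_q[OF B, of "w (2*i)", folded m] qw[OF ir] by (auto simp: i_def)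
  have ev: "even (w (2*i))" "w (2*i) \<le> 2*n+1" "1 \<le> w (2*i)" using parity[OF ir] w_range[OF ir] by auto
  show ?thesis
  proof (cases "odd i")
    case True
    then have k: "odd (b + m + 1)" using full by (auto simp: right_full_def i_def)
    have "2 * (b+m+1) \<le> w (2*i)" using out win pos_types(1)[OF i True] ev by auto
    moreover have False if lt: "2 * (b+m+1) < w (2*i)"
    proof -
      have kn: "b + m + 1 \<le> n" using lt ev by auto
      have "q (2*(b+m)+1) < q (2*(b+m+1))"
        using val_types(1)[OF _ kn k] by simp
      moreover have "2*a+1 \<le> q (2*(b+m)+1)" using block_q[OF B, of "2*(b+m)+1", folded m] by simp
      moreover have "q (2*(b+m+1)) < 2*i-1"
        using before_up[OF p _ lt] win by auto
      ultimately have "2*b+1 \<le> w (q (2*(b+m+1))) \<and> w (q (2*(b+m+1))) \<le> 2*(b+m)+1"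
        using block_w[OF B, of "q (2*(b+m+1))", folded m] i1 by auto
      then show False using wq[of "2*(b+m+1)"] kn by auto
    qed
    ultimately show ?thesis using True by (force simp: i_def)
  next
    case False
    then have even: "even i" and k: "even b" using full by (auto simp: right_full_def i_def)
    have "w (2*i) \<le> 2*b" using out win pos_types(2)[OF i even] ev by auto
    moreover have False if lt: "w (2*i) < 2*b"
    proof -
      have kn: "1 \<le> b" "b \<le> n" using lt block_fits[OF B] by auto
      have "q (2*b+1) < q (2*b)" using val_types(2)[OF kn k] by simp
      moreover have "2*a+1 \<le> q (2*b+1)" using block_q[OF B, of "2*b+1", folded m] by simp
      moreover have "q (2*b) < 2*i-1" using before_down[OF p lt] win by auto
      ultimately have "2*b+1 \<le> w (q (2*b))"
        using block_w[OF B, of "q (2*b)", folded m] i1 by auto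
      then show False using wq[of "2*b"] kn by auto
    qed
    ultimately show ?thesis using even by (force simp: i_def)
  qed
qed

lemma left_full_neighbour:
  assumes B: "block a b xs" and m: "m = length xs" and full: "left_full a b m" and a: "1 \<le> a"
  shows "odd a \<and> w (2 * a) = 2 * b \<or> even a \<and> w (2 * a) = 2 * (b + m + 1)"
proof -
  have i: "1 \<le> a" "a \<le> n" using a block_fits[OF B] by auto
  have p: "even (2*a)" "1 \<le> 2*a" "2*a \<le> 2*n" and ir: "2*a \<in> {1..2*n+1}" using i by auto
  have win: "2*b+1 \<le> w (2*a+1)" "w (2*a+1) \<le> 2*(b+m)+1" using block_w[OF B, of "2*a+1", folded m] by auto
  have out: "\<not> (2*b+1 \<le> w (2*a) \<and> w (2*a) \<le> 2*(b+m)+1)"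
    using block_q[OF B, of "w (2*a)", folded m] qw[OF ir] by auto
  have ev: "even (w (2*a))" "w (2*a) \<le> 2*n+1" "1 \<le> w (2*a)" using parity[OF ir] w_range[OF ir] by auto
  show ?thesis
  proof (cases "odd a")
    case True
    then have k: "odd b" using full by (auto simp: left_full_def)
    have "w (2*a) \<le> 2*b" using out win pos_types(1)[OF i True] ev by auto
    moreover have False if lt: "w (2*a) < 2*b"
    proof -
      have kn: "1 \<le> b" "b \<le> n" using lt block_fits[OF B] by auto
      have "q (2*b) < q (2*b+1)" using val_types(1)[OF kn k] by simp
      moreover have "q (2*b+1) \<le> 2*(a+m)+1" using block_q[OF B, of "2*b+1", folded m] by simp
      moreover have "2*a+1 < q (2*b)" using after_up[OF p lt] win by auto
      ultimately have "2*b+1 \<le> w (q (2*b))"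
        using block_w[OF B, of "q (2*b)", folded m] by auto
      then show False using wq[of "2*b"] kn by auto
    qed
    ultimately show ?thesis using True by force
  next
    case False
    then have even: "even a" and k: "even (b+m+1)" using full by (auto simp: left_full_def)
    have "2*(b+m+1) \<le> w (2*a)" using out win pos_types(2)[OF i even] ev by auto
    moreover have False if lt: "2 * (b+m+1) < w (2*a)"
    proof -
      have kn: "b + m + 1 \<le> n" using lt ev by auto
      have "q (2*(b+m+1)) < q (2*(b+m)+1)"
        using val_types(2)[OF _ kn k] by simp
      moreover have "q (2*(b+m)+1) \<le> 2*(a+m)+1" using block_q[OF B, of "2*(b+m)+1", folded m] by simp
      moreover have "2*a+1 < q (2*(b+m+1))" using after_down[OF p _ lt] win by auto
      ultimately have "w (q (2*(b+m+1))) \<le> 2*(b+m)+1"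
        using block_w[OF B, of "q (2*(b+m+1))", folded m] by auto
      then show False using wq[of "2*(b+m+1)"] kn by auto
    qed
    ultimately show ?thesis using even by force
  qed
qed

lemma merge:
  assumes "block a b xs" "block (a + length xs + 1) b' ys"
    and "right_full a b (length xs)" "left_full (a + length xs + 1) b' (length ys)"
  shows "\<exists>b'' zs. block a b'' zs \<and> length xs < length zs"
proof -
  have r: "a + length xs + 1 \<le> n" using block_fits[OF assms(2)] by auto
  note R = right_full_neighbour[OF assms(1) refl assms(3) r]
  note L = left_full_neighbour[OF assms(2) refl assms(4)]
  show ?thesis
  proof (cases "odd (a + length xs + 1)")
    case True
    then have "b' = b + length xs + 1" "w (2 * (a + length xs + 1)) = 2 * (b + length xs + 1)"
      using R L by auto
    then have "block a b (xs \<oplus>\<^sub>p [1] \<oplus>\<^sub>p ys)" using assms ascent True by auto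
    then show ?thesis by force
  next
    case False
    then have "b = b' + length ys + 1" "w (2 * (a + length xs + 1)) = 2 * (b' + length ys + 1)"
      using R L by auto
    then have "block a b' (xs \<ominus>\<^sub>p [1] \<ominus>\<^sub>p ys)" using assms descent False by auto
    then show ?thesis by force
  qed
qed

text \<open>
  At the right end of \<open>w\<close> being right full would not help; a block there that is not left full would
  have an ascent as its upper neighbour, and this entry would have to lie to its right.
\<close>
lemma right_end_left_full:
  assumes B: "block a b xs" and e: "a + length xs = n"
  shows "left_full a b (length xs)"
proof (rule ccontr)
  let ?k = "b + length xs + 1"
  assume neg: "\<not> ?thesis"
  then have par: "odd a" "even (length xs)" "even b"
    using block_parity[OF B] odd_n e by (auto simp: left_full_def)
  then have kn: "?k \<le> n" "odd ?k" using block_fits[OF B] odd_n by (auto simp: le_less)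
  then have "q (2*(b+length xs)+1) < q (2 * ?k)" using val_types(1)[of ?k] by simp
  moreover have "2*a+1 \<le> q (2*(b+length xs)+1)" using block_q[OF B, of "2*(b+length xs)+1"] by simp
  moreover have "q (2 * ?k) \<le> 2*(a+length xs)+1" using q_range[of "2 * ?k"] kn e by auto
  ultimately have "w (q (2 * ?k)) \<le> 2*(b+length xs)+1"
    using block_w[OF B, of "q (2 * ?k)"] by auto
  then show False using wq[of "2 * ?k"] kn by auto
qed

text \<open>
  Take the longest block that starts at the given position. If it leaned on its right neighbour, the
  induction hypothesis would give a block beyond that neighbour which leans on it from the other
  side, and the two could be merged.
\<close>
lemma block_not_extending_right:
  assumes "a \<le> n"
  shows "\<exists>b xs. block a b xs \<and> \<not> (right_full a b (length xs) \<and> a + length xs < n)"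
  using assms
proof (induction "n - a" arbitrary: a rule: less_induct)
  case less
  have "odd (w (2*a+1))" using parity[of "2*a+1"] less.prems by auto
  then obtain b where "w (2*a+1) = 2*b+1" by (auto elim: oddE)
  then have "block a b []" using leaf less.prems by blast
  then have "\<exists>m b xs. block a b xs \<and> length xs = m" by blast
  moreover have "\<forall>m. (\<exists>b xs. block a b xs \<and> length xs = m) \<longrightarrow> m \<le> n"
    using block_fits by fastforce
  ultimately obtain m where m: "\<exists>b xs. block a b xs \<and> length xs = m"
      and max: "\<And>m'. (\<exists>b xs. block a b xs \<and> length xs = m') \<Longrightarrow> m' \<le> m"
    using Nat.ex_has_greatest_nat[of "\<lambda>m. \<exists>b xs. block a b xs \<and> length xs = m" _ n] by metis
  then obtain b xs where B: "block a b xs" "length xs = m" by blast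
  have "\<not> (right_full a b (length xs) \<and> a + length xs < n)"
  proof
    assume r: "right_full a b (length xs) \<and> a + length xs < n"
    then obtain b' ys where C: "block (a + length xs + 1) b' ys"
        "\<not> (right_full (a + length xs + 1) b' (length ys) \<and> a + length xs + 1 + length ys < n)"
      using less.hyps[of "a + length xs + 1"] by force
    then have "left_full (a + length xs + 1) b' (length ys)"
      using left_or_right_full[OF C(1)] right_end_left_full[OF C(1)] block_fits[OF C(1)] by (auto simp: le_less)
    then show False using merge[OF B(1) C(1)] r max B(2) by fastforce
  qed
  then show ?case using B by blast
qed

text \<open>
  Take the block at the leftmost position given by the previous lemma and suppose it were not all
  of \<open>w\<close>. It is left full, so its upper neighbour is a descent, which would lie to the left of the
  block; hence the block contains the largest values. As it is not right full, its lower neighbour is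
  an ascent, which would lie to the left of the block as well.
\<close>
proposition block_everything: "\<exists>xs. block 0 0 xs \<and> length xs = n"
proof -
  obtain b xs where B: "block 0 b xs" and nr: "\<not> (right_full 0 b (length xs) \<and> length xs < n)"
    using block_not_extending_right[of 0] by auto
  let ?m = "length xs"
  have "?m = n"
  proof (rule ccontr)
    assume ne: "?m \<noteq> n"
    then have "?m < n" using block_fits[OF B] by simp
    then have nr: "\<not> right_full 0 b ?m" using nr by simp
    then have k: "even (b + ?m + 1)" using left_or_right_full[OF B] by (auto simp: left_full_def)
    have high: "2*0+1 \<le> q (2*(b+?m)+1)" "q (2*(b+?m)+1) \<le> 2*(0+?m)+1"
      and low: "2*0+1 \<le> q (2*b+1)" "q (2*b+1) \<le> 2*(0+?m)+1"
      using block_q[OF B, of "2*(b+?m)+1"] block_q[OF B, of "2*b+1"] by auto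
    show False
    proof (cases "b + ?m + 1 \<le> n")
      case True
      then have "q (2*(b+?m+1)) < q (2*(b+?m)+1)" using val_types(2)[OF _ True k] by simp
      moreover have "1 \<le> q (2*(b+?m+1))" using q_range[of "2*(b+?m+1)"] True by auto
      ultimately have "w (q (2*(b+?m+1))) \<le> 2*(b+?m)+1"
        using block_w[OF B, of "q (2*(b+?m+1))"] high by auto
      then show False using wq[of "2*(b+?m+1)"] True by auto
    next
      case False
      have bo: "odd b" using nr k by (auto simp: right_full_def)
      then have b: "1 \<le> b" "b \<le> n" using block_fits[OF B] by (auto elim: oddE)
      have "q (2*b) < q (2*b+1)" using val_types(1)[OF b bo] by simp
      moreover have "1 \<le> q (2*b)" using q_range[of "2*b"] b by auto
      ultimately have "2*b+1 \<le> w (q (2*b))" using block_w[OF B, of "q (2*b)"] low by auto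
      then show False using wq[of "2*b"] b by auto
    qed
  qed
  moreover have "b = 0" using block_fits[OF B] calculation by simp
  ultimately show ?thesis using B by blast
qed

end

section \<open>The grammar read off from the blocks\<close>

inductive leopard :: "nat list \<Rightarrow> bool" where
  one: "leopard [1]"
| frame: "leopard x \<Longrightarrow> leopard ([1] \<oplus>\<^sub>p complement x \<oplus>\<^sub>p [1])"
| skew: "leopard x \<Longrightarrow> leopard y \<Longrightarrow> leopard (x \<ominus>\<^sub>p [1] \<ominus>\<^sub>p y)"

lemma leopard_perm: "leopard x \<Longrightarrow> is_perm x \<and> odd (length x)"
  by (induction rule: leopard.induct) auto

definition co_leopard :: "nat list \<Rightarrow> bool" where
  "co_leopard x \<longleftrightarrow> is_perm x \<and> leopard (complement x)"

lemma co_leopard_sum: "co_leopard x \<Longrightarrow> co_leopard y \<Longrightarrow> co_leopard (x \<oplus>\<^sub>p [1] \<oplus>\<^sub>p y)"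
  using leopard.skew by (auto simp: co_leopard_def complement_sum)

lemma co_leopard_frame: "leopard x \<Longrightarrow> co_leopard ([1] \<ominus>\<^sub>p x \<ominus>\<^sub>p [1])"
  using leopard_perm[of x] leopard.frame[of x] by (auto simp: co_leopard_def complement_skew)

lemma leopard_frame: "co_leopard x \<Longrightarrow> leopard ([1] \<oplus>\<^sub>p x \<oplus>\<^sub>p [1])"
  using leopard.frame[of "complement x"] by (auto simp: co_leopard_def)

lemma co_leopard_one: "co_leopard [1]"
  by (simp add: co_leopard_def leopard.one[simplified])

text \<open>
  The form of the even entries of a block, where \<open>a\<close> and \<open>b\<close> tell whether the block starts after an
  even number of even positions and of even values. A block with an odd number of even entries is a
  snow leopard or a complement of one. Otherwise it is a degenerate single entry or it is such a
  permutation with one entry attached at the corner that the two parities determine.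
\<close>
definition parity_shape :: "bool \<Rightarrow> bool \<Rightarrow> nat list \<Rightarrow> bool" where
  "parity_shape a b xs \<longleftrightarrow>
    (if odd (length xs) then (if a then leopard xs else co_leopard xs)
     else xs = [] \<or> (\<exists>x. if a then (if b then co_leopard x \<and> xs = [1] \<oplus>\<^sub>p x else leopard x \<and> xs = x \<ominus>\<^sub>p [1])
                         else (if b then leopard x \<and> xs = [1] \<ominus>\<^sub>p x else co_leopard x \<and> xs = x \<oplus>\<^sub>p [1])))"

lemma shape_ascent:
  assumes "parity_shape a a xs" "parity_shape False False ys" "even (length xs) \<longleftrightarrow> a"
  shows "parity_shape a a (xs \<oplus>\<^sub>p [1] \<oplus>\<^sub>p ys)"
proof -
  have L1: "leopard [Suc 0]" using leopard.one by simp
  note sum = co_leopard_sum[simplified] and fr = leopard_frame[simplified]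
  show ?thesis
  proof (cases a; cases "even (length ys)")
    assume a: a and e: "even (length ys)"
    then have x: "xs = [] \<or> (\<exists>x. co_leopard x \<and> xs = [1] \<oplus>\<^sub>p x)"
      and y: "ys = [] \<or> (\<exists>x. co_leopard x \<and> ys = x \<oplus>\<^sub>p [1])"
      using assms by (auto simp: parity_shape_def)
    then have "leopard (xs \<oplus>\<^sub>p [1] \<oplus>\<^sub>p ys)" using L1 sum fr fr[OF sum] by auto
    then show ?thesis using a e assms(3) by (auto simp: parity_shape_def)
  next
    assume a: a and e: "odd (length ys)"
    then have x: "xs = [] \<or> (\<exists>x. co_leopard x \<and> xs = [1] \<oplus>\<^sub>p x)" and y: "co_leopard ys"
      using assms by (auto simp: parity_shape_def)
    then have "\<exists>x. co_leopard x \<and> xs \<oplus>\<^sub>p [1] \<oplus>\<^sub>p ys = [1] \<oplus>\<^sub>p x"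
    proof (cases "xs = []")
      case True
      then show ?thesis using y by auto
    next
      case False
      then obtain x' where "co_leopard x'" "xs = [1] \<oplus>\<^sub>p x'" using x by auto
      then show ?thesis using y co_leopard_sum[of x' ys] by (intro exI[of _ "x' \<oplus>\<^sub>p [1] \<oplus>\<^sub>p ys"]) auto
    qed
    then show ?thesis using a e assms(3) by (auto simp: parity_shape_def)
  next
    assume a: "\<not> a" and e: "even (length ys)"
    then have x: "co_leopard xs" and y: "ys = [] \<or> (\<exists>x. co_leopard x \<and> ys = x \<oplus>\<^sub>p [1])"
      using assms by (auto simp: parity_shape_def)
    then have "\<exists>x. co_leopard x \<and> xs \<oplus>\<^sub>p [1] \<oplus>\<^sub>p ys = x \<oplus>\<^sub>p [1]"
    proof (cases "ys = []")
      case True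
      then show ?thesis using x by auto
    next
      case False
      then obtain y' where "co_leopard y'" "ys = y' \<oplus>\<^sub>p [1]" using y by auto
      then show ?thesis using x co_leopard_sum[of xs y'] by (intro exI[of _ "xs \<oplus>\<^sub>p [1] \<oplus>\<^sub>p y'"]) auto
    qed
    then show ?thesis using a e assms(3) by (auto simp: parity_shape_def)
  next
    assume a: "\<not> a" and e: "odd (length ys)"
    then have "co_leopard xs" "co_leopard ys" using assms by (auto simp: parity_shape_def)
    then show ?thesis using sum a e assms(3) by (auto simp: parity_shape_def)
  qed
qed

lemma shape_descent:
  assumes "parity_shape a True xs" "parity_shape True b ys" "odd (length xs) \<longleftrightarrow> a" "odd (length ys) \<longleftrightarrow> b"
  shows "parity_shape a b (xs \<ominus>\<^sub>p [1] \<ominus>\<^sub>p ys)"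
proof -
  have C1: "co_leopard [Suc 0]" using co_leopard_one by simp
  note sk = leopard.skew[simplified] and fr = co_leopard_frame[simplified]
  have x: "if a then leopard xs else xs = [] \<or> (\<exists>x. leopard x \<and> xs = [1] \<ominus>\<^sub>p x)"
    using assms(1,3) by (auto simp: parity_shape_def)
  have y: "if b then leopard ys else ys = [] \<or> (\<exists>y. leopard y \<and> ys = y \<ominus>\<^sub>p [1])"
    using assms(2,4) by (auto simp: parity_shape_def)
  show ?thesis
  proof (cases a; cases b)
    assume "a" "b"
    then show ?thesis using x y sk assms(3,4) by (auto simp: parity_shape_def)
  next
    assume ab: "a" "\<not> b"
    then have "\<exists>x. leopard x \<and> xs \<ominus>\<^sub>p [1] \<ominus>\<^sub>p ys = x \<ominus>\<^sub>p [1]"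
    proof (cases "ys = []")
      case True
      then show ?thesis using x ab by auto
    next
      case False
      then obtain y' where "leopard y'" "ys = y' \<ominus>\<^sub>p [1]" using y ab by auto
      then show ?thesis using x ab leopard.skew[of xs y'] by (intro exI[of _ "xs \<ominus>\<^sub>p [1] \<ominus>\<^sub>p y'"]) auto
    qed
    then show ?thesis using ab assms(3,4) by (auto simp: parity_shape_def)
  next
    assume ab: "\<not> a" "b"
    then have "\<exists>x. leopard x \<and> xs \<ominus>\<^sub>p [1] \<ominus>\<^sub>p ys = [1] \<ominus>\<^sub>p x"
    proof (cases "xs = []")
      case True
      then show ?thesis using y ab by auto
    next
      case False
      then obtain x' where "leopard x'" "xs = [1] \<ominus>\<^sub>p x'" using x ab by auto
      then show ?thesis using y ab leopard.skew[of x' ys] by (intro exI[of _ "x' \<ominus>\<^sub>p [1] \<ominus>\<^sub>p ys"]) auto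
    qed
    then show ?thesis using ab assms(3,4) by (auto simp: parity_shape_def)
  next
    assume ab: "\<not> a" "\<not> b"
    then have "co_leopard (xs \<ominus>\<^sub>p [1] \<ominus>\<^sub>p ys)"
      using x y C1 fr fr[OF sk] by auto
    then show ?thesis using ab assms(3,4) by (auto simp: parity_shape_def)
  qed
qed

lemma (in alternating_Baxter) block_shape: "block a b xs \<Longrightarrow> parity_shape (even a) (even b) xs"
proof (induction rule: block.induct)
  case (leaf a b)
  then show ?case by (simp add: parity_shape_def)
next
  case (ascent a b xs ys)
  have "even (a + length xs + 1) = even (b + length xs + 1)"
    using parity_preserving[OF _ _ ascent.hyps(4)] block_fits[OF ascent.hyps(2)] by auto
  then have b: "even b = even a" by auto
  have p: "even (a + length xs + 1) = False" "even (b + length xs + 1) = False"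
    using ascent.hyps(3) b by simp_all
  have "even (length xs) \<longleftrightarrow> even a" using ascent.hyps(3) by simp
  from shape_ascent[OF ascent.IH[unfolded b p] this] show ?case unfolding b .
next
  case (descent a b ys xs)
  have "even (a + length xs + 1) = even (b + length ys + 1)"
    using parity_preserving[OF _ _ descent.hyps(4)] block_fits[OF descent.hyps(2)] by auto
  then have p: "even (a + length xs + 1) = True" "even (b + length ys + 1) = True"
    using descent.hyps(3) by simp_all
  have "odd (length xs) \<longleftrightarrow> even a" "odd (length ys) \<longleftrightarrow> even b" using p by simp_all
  from shape_descent[OF descent.IH[unfolded p] this] show ?case .
qed

proposition (in alternating_Baxter) leopard_of_even_entries:
  assumes "length \<sigma> = n" "\<And>i. i < n \<Longrightarrow> w (2 * (i + 1)) = 2 * \<sigma> ! i"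
  shows "leopard \<sigma>"
proof -
  obtain xs where B: "block 0 0 xs" "length xs = n" using block_everything by blast
  then have "\<sigma> = xs"
    using block_entries[OF B(1)] assms by (intro nth_equalityI) auto
  then show ?thesis using block_shape[OF B(1)] B(2) odd_n by (simp add: parity_shape_def)
qed

section \<open>From snow leopards to the grammar\<close>

lemma filter_nth: "filter P xs = map ((!) xs) (filter (\<lambda>i. P (xs ! i)) [0..<length xs])"
  by (metis (no_types, lifting) filter_cong filter_map map_nth o_apply)

lemma filter_even_upt:
  "filter odd [0..<2*n+1] = map (\<lambda>i. 2*i+1) [0..<n]" "filter even [0..<2*n+1] = map (\<lambda>i. 2*i) [0..<n+1]"
  by (induction n) auto

lemma entry_bij:
  assumes "is_perm \<pi>" shows "bij_betw (entry \<pi>) {1..length \<pi>} {1..length \<pi>}"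
proof -
  have "entry \<pi> ` {1..length \<pi>} = set \<pi>"
  proof (intro equalityI subsetI)
    fix v assume "v \<in> set \<pi>"
    then obtain i where "i < length \<pi>" "\<pi> ! i = v" by (auto simp: in_set_conv_nth)
    then show "v \<in> entry \<pi> ` {1..length \<pi>}" by (intro image_eqI[of _ _ "i + 1"]) (auto simp: entry_def)
  qed (auto simp: entry_def)
  moreover have "inj_on (entry \<pi>) {1..length \<pi>}"
    using assms by (auto simp: inj_on_def entry_def is_perm_def nth_eq_iff_index_eq)
  ultimately show ?thesis using assms by (auto simp: bij_betw_def is_perm_def)
qed

lemma perm_inverse_nth:
  "v < length \<pi> \<Longrightarrow> perm_inverse \<pi> ! v = inv_into {1..length \<pi>} (entry \<pi>) (v + 1)"
  by (simp add: perm_inverse_def del: upt_Suc)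

lemma length_perm_inverse [simp]: "length (perm_inverse \<pi>) = length \<pi>"
  by (simp add: perm_inverse_def del: upt_Suc)

lemma length_standardize [simp]: "length (standardize xs) = length xs"
  by (simp add: standardize_def)

lemma entry_perm_inverse:
  assumes "is_perm \<pi>" "j \<in> {1..length \<pi>}"
  shows "entry (perm_inverse \<pi>) (entry \<pi> j) = j"
proof -
  have "entry \<pi> j \<in> {1..length \<pi>}" using entry_bij[OF assms(1)] assms(2) by (auto simp: bij_betw_def)
  then have "entry (perm_inverse \<pi>) (entry \<pi> j) = inv_into {1..length \<pi>} (entry \<pi>) (entry \<pi> j)"
    using perm_inverse_nth[of "entry \<pi> j - 1" \<pi>] by (auto simp: entry_def[of "perm_inverse \<pi>"])
  then show ?thesis
    using entry_bij[OF assms(1)] assms(2) by (simp add: bij_betw_def)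
qed

lemma standardize_odds:
  assumes "set xs = {v \<in> {1..2*n+1}. odd v}"
  shows "standardize xs = map (\<lambda>x. (x + 1) div 2) xs"
  unfolding standardize_def
proof (rule map_cong[OF refl])
  fix x assume "x \<in> set xs"
  then obtain k where k: "x = 2*k+1" "x \<le> 2*n+1" using assms by (auto elim: oddE)
  have "{y \<in> set xs. y \<le> x} = (\<lambda>i. 2*i+1) ` {..k}"
    using assms k by (force elim: oddE)
  then show "card {y \<in> set xs. y \<le> x} = (x + 1) div 2"
    using k by (simp add: card_image inj_on_def)
qed

lemma standardize_evens:
  assumes "set xs = {v \<in> {1..2*n+1}. even v}"
  shows "standardize xs = map (\<lambda>x. x div 2) xs"
  unfolding standardize_def
proof (rule map_cong[OF refl])
  fix x assume "x \<in> set xs"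
  then obtain k where k: "x = 2*k" "x \<le> 2*n+1" "1 \<le> k" using assms by (auto elim!: evenE)
  have "{y \<in> set xs. y \<le> x} = (\<lambda>i. 2*i) ` {1..k}"
    using assms k by (force elim!: evenE)
  then show "card {y \<in> set xs. y \<le> x} = x div 2"
    using k by (simp add: card_image inj_on_def)
qed

lemma odd_even_entries:
  assumes "is_perm \<pi>" "length \<pi> = 2*n+1" "\<And>j. j \<in> {1..length \<pi>} \<Longrightarrow> even (entry \<pi> j) \<longleftrightarrow> even j"
  shows "standardize (filter even \<pi>) = map (\<lambda>i. entry \<pi> (2*(i+1)) div 2) [0..<n]"
    and "standardize (filter odd \<pi>) = map (\<lambda>i. (entry \<pi> (2*i+1) + 1) div 2) [0..<n+1]"
proof -
  have par: "even (\<pi> ! i) \<longleftrightarrow> odd i" if "i < 2*n+1" for i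
    using assms(3)[of "i+1"] that assms(2) by (simp add: entry_def)
  have "filter even \<pi> = map ((!) \<pi>) (filter odd [0..<2*n+1])"
    unfolding filter_nth[of even \<pi>] assms(2) by (intro arg_cong[of _ _ "map _"] filter_cong refl) (auto simp: par)
  then have e: "filter even \<pi> = map (\<lambda>i. entry \<pi> (2*(i+1))) [0..<n]"
    using filter_even_upt[of n] by (simp add: entry_def del: upt_Suc)
  have "filter odd \<pi> = map ((!) \<pi>) (filter even [0..<2*n+1])"
    unfolding filter_nth[of odd \<pi>] assms(2) by (intro arg_cong[of _ _ "map _"] filter_cong refl) (auto simp: par)
  then have o: "filter odd \<pi> = map (\<lambda>i. entry \<pi> (2*i+1)) [0..<n+1]"
    using filter_even_upt[of n] by (simp add: entry_def del: upt_Suc)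
  show "standardize (filter even \<pi>) = map (\<lambda>i. entry \<pi> (2*(i+1)) div 2) [0..<n]"
  proof -
    have "set (filter even \<pi>) = {v \<in> {1..2*n+1}. even v}" using assms(1,2) by (auto simp: is_perm_def)
    from standardize_evens[OF this] show ?thesis unfolding e by (simp add: comp_def del: upt_Suc)
  qed
  show "standardize (filter odd \<pi>) = map (\<lambda>i. (entry \<pi> (2*i+1) + 1) div 2) [0..<n+1]"
  proof -
    have "set (filter odd \<pi>) = {v \<in> {1..2*n+1}. odd v}" using assms(1,2) by (auto simp: is_perm_def)
    from standardize_odds[OF this] show ?thesis unfolding o by (simp add: comp_def del: upt_Suc)
  qed
qed

text \<open>
  A witness \<open>\<pi>\<close> of \<open>\<sigma>\<close> has the entry \<open>2\<sigma>(i)\<close> at position \<open>2i\<close>, and \<open>2\<beta>(i) - 1\<close> at position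
  \<open>2i - 1\<close>, where \<open>\<beta>\<close> is the permutation induced on the odd entries. So the order of two entries of
  \<open>\<beta>\<close>, or of its inverse, is that of the corresponding entries of \<open>\<pi>\<close>, or of its inverse.
\<close>
proposition leopard_if_snow_leopard:
  assumes "snow_leopard (Perm \<sigma>)" "odd (length \<sigma>)"
  shows "leopard \<sigma>"
proof -
  define n where "n = length \<sigma>"
  obtain \<pi> where len: "length \<pi> = 2*n+1" and cb: "complete_Baxter \<pi>"
    and ev: "standardize (filter even \<pi>) = \<sigma>" and da: "doubly_alternating (standardize (filter odd \<pi>))"
    using assms(1) by (auto simp: n_def)
  have pp: "is_perm \<pi>" using cb perms_iff by (auto simp: complete_Baxter_def)
  have par: "even (entry \<pi> j) \<longleftrightarrow> even j" if "j \<in> {1..2*n+1}" for j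
    using cb that len by (auto simp: complete_Baxter_def)
  define \<beta> where "\<beta> = standardize (filter odd \<pi>)"
  have beta: "\<beta> = map (\<lambda>i. (entry \<pi> (2*i+1) + 1) div 2) [0..<n+1]"
    using odd_even_entries(2)[OF pp len] par len by (simp add: \<beta>_def)
  have sigma: "\<sigma> = map (\<lambda>i. entry \<pi> (2*(i+1)) div 2) [0..<n]"
    using odd_even_entries(1)[OF pp len] par len ev by simp
  define q where "q = inv_into {1..2*n+1} (entry \<pi>)"
  have bij: "bij_betw (entry \<pi>) {1..2*n+1} {1..2*n+1}" using entry_bij[OF pp] len by simp
  have lb: "length \<beta> = n + 1" unfolding beta by simp
  have eb: "entry \<beta> i = (entry \<pi> (2*i-1) + 1) div 2" if "1 \<le> i" "i \<le> n+1" for i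
    using that unfolding beta entry_def[of "map _ _"] by (cases i) (auto simp del: upt_Suc)
  have range: "entry \<pi> j \<in> {1..2*n+1}" if "j \<in> {1..2*n+1}" for j
    using bij that by (auto simp: bij_betw_def)
  have eb2: "2 * entry \<beta> i = entry \<pi> (2*i-1) + 1" if "1 \<le> i" "i \<le> n+1" for i
  proof -
    have "2*i-1 \<in> {1..2*n+1}" "odd (2*i-1)" using that by auto
    then have "odd (entry \<pi> (2*i-1))" using par by blast
    then show ?thesis using eb[OF that] by presburger
  qed
  have qq: "q v \<in> {1..2*n+1} \<and> entry \<pi> (q v) = v" if "v \<in> {1..2*n+1}" for v
    using bij that unfolding q_def by (metis bij_betw_def f_inv_into_f inv_into_into)
  have qe: "q (entry \<pi> j) = j" if "j \<in> {1..2*n+1}" for j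
    using bij that unfolding q_def by (simp add: bij_betw_def)
  have permb: "is_perm \<beta>"
  proof (rule is_permI)
    show "distinct \<beta>"
    proof (subst distinct_conv_nth, intro allI impI)
      fix i j assume ij: "i < length \<beta>" "j < length \<beta>" "i \<noteq> j"
      have "2 * entry \<beta> (i+1) \<noteq> 2 * entry \<beta> (j+1)"
        using eb2[of "i+1"] eb2[of "j+1"] ij lb qe[of "2*i+1"] qe[of "2*j+1"] by auto
      then show "\<beta> ! i \<noteq> \<beta> ! j" by (simp add: entry_def)
    qed
    fix v assume "v \<in> set \<beta>"
    then obtain i where "i < n + 1" "v = entry \<beta> (i+1)" using lb by (auto simp: in_set_conv_nth entry_def)
    then show "1 \<le> v \<and> v \<le> length \<beta>" using eb2[of "i+1"] range[of "2*i+1"] lb by auto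
  qed
  have ib: "2 * entry (perm_inverse \<beta>) i = q (2*i-1) + 1" if "1 \<le> i" "i \<le> n+1" for i
  proof -
    have "2*i-1 \<in> {1..2*n+1}" using that by auto
    then have qr: "q (2*i-1) \<in> {1..2*n+1}" "entry \<pi> (q (2*i-1)) = 2*i-1" using qq by blast+
    then have "odd (q (2*i-1))" using par[OF qr(1)] that by auto
    then obtain k where k: "q (2*i-1) = 2*k+1" by (auto elim: oddE)
    have "entry \<beta> (k+1) = i" using eb2[of "k+1"] k qr that by auto
    then have "entry (perm_inverse \<beta>) i = k+1"
      using entry_perm_inverse[OF permb, of "k+1"] lb k qr by auto
    then show ?thesis using k by simp
  qed
  have alt: "alternating \<beta>" "alternating (perm_inverse \<beta>)"
    using da by (auto simp: doubly_alternating_def \<beta>_def)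
  interpret alternating_Baxter n "entry \<pi>" q
  proof unfold_locales
    show "odd n" using assms(2) by (simp add: n_def)
    fix i z assume i: "1 \<le> i" "i \<le> 2*n" and z: "q i < z \<and> z < q (i + 1) \<or> q (i + 1) < z \<and> z < q i"
    have "q i \<in> {1..2*n+1}" "q (i+1) \<in> {1..2*n+1}" "entry \<pi> (q i) = i" "entry \<pi> (q (i+1)) = i+1"
      using qq[of i] qq[of "i+1"] i by auto
    moreover have "z \<in> {1..2*n+1}" using calculation z by auto
    ultimately show "(odd i \<longrightarrow> entry \<pi> z < i) \<and> (even i \<longrightarrow> i + 1 < entry \<pi> z)"
      using cb[unfolded complete_Baxter_def, THEN conjunct2, THEN conjunct2, rule_format, of "q i" "q (i+1)" z i] z len
      by simp
  next
    fix i assume i: "1 \<le> i" "i \<le> n"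
    have "(odd i \<longrightarrow> entry \<beta> i < entry \<beta> (i+1)) \<and> (even i \<longrightarrow> entry \<beta> (i+1) < entry \<beta> i)"
      using alt(1) i lb by (auto simp: alternating_def)
    then show "(odd i \<longrightarrow> entry \<pi> (2*i-1) < entry \<pi> (2*i+1)) \<and> (even i \<longrightarrow> entry \<pi> (2*i+1) < entry \<pi> (2*i-1))"
      using eb2[of i] eb2[of "i+1"] i by auto
    have "(odd i \<longrightarrow> entry (perm_inverse \<beta>) i < entry (perm_inverse \<beta>) (i+1)) \<and>
        (even i \<longrightarrow> entry (perm_inverse \<beta>) (i+1) < entry (perm_inverse \<beta>) i)"
      using alt(2) i lb by (auto simp: alternating_def)
    then show "(odd i \<longrightarrow> q (2*i-1) < q (2*i+1)) \<and> (even i \<longrightarrow> q (2*i+1) < q (2*i-1))"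
      using ib[of i] ib[of "i+1"] i by auto
  qed (use qq qe par range in auto)
  show ?thesis
  proof (rule leopard_of_even_entries)
    fix i assume i: "i < n"
    then have "\<sigma> ! i = entry \<pi> (2*(i+1)) div 2" unfolding sigma by simp
    moreover have "even (entry \<pi> (2*(i+1)))" using par[of "2*(i+1)"] i by auto
    ultimately show "entry \<pi> (2*(i+1)) = 2 * \<sigma> ! i" by simp
  qed (simp add: n_def)
qed

section \<open>Even and odd entries of sums\<close>

lemma standardize_map_mono:
  assumes "strict_mono_on (set xs) f"
  shows "standardize (map f xs) = standardize xs"
  unfolding standardize_def map_map
proof (rule map_cong[OF refl])
  fix x assume x: "x \<in> set xs"
  have "{y \<in> set (map f xs). y \<le> f x} = f ` {y \<in> set xs. y \<le> x}"
    using x strict_mono_on_less_eq[OF assms] by auto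
  moreover have "inj_on f {y \<in> set xs. y \<le> x}"
    using strict_mono_on_imp_inj_on[OF assms] by (rule inj_on_subset) auto
  ultimately show "((\<lambda>x. card {y \<in> set (map f xs). y \<le> x}) \<circ> f) x = card {y \<in> set xs. y \<le> x}"
    by (simp add: card_image)
qed

lemma card_le_bound: "card {y \<in> set xs. y \<le> (x::nat)} \<le> length xs"
  by (rule order_trans[OF card_mono card_length[of xs]]) auto

lemma standardize_map_antimono:
  assumes "strict_antimono_on (set xs) f" "distinct xs"
  shows "standardize (map f xs) = complement (standardize xs)"
  unfolding standardize_def map_map complement_def length_map
proof (rule map_cong[OF refl])
  fix x assume x: "x \<in> set xs"
  have mono: "y < z \<Longrightarrow> f z < f y" if "y \<in> set xs" "z \<in> set xs" for y z
    using assms(1) that by (auto simp: monotone_on_def)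
  then have inj: "inj_on f (set xs)" by (metis inj_onI linorder_neqE_nat less_irrefl)
  have "{y \<in> set (map f xs). y \<le> f x} = f ` {y \<in> set xs. x \<le> y}"
    using x mono by (auto simp: image_iff) (metis leI leD, metis le_less)
  moreover have "inj_on f {y \<in> set xs. x \<le> y}"
    using inj by (rule inj_on_subset) auto
  ultimately have 1: "card {y \<in> set (map f xs). y \<le> f x} = card {y \<in> set xs. x \<le> y}"
    by (simp add: card_image)
  have "{y \<in> set xs. x \<le> y} \<union> {y \<in> set xs. y \<le> x} = set xs" "{y \<in> set xs. x \<le> y} \<inter> {y \<in> set xs. y \<le> x} = {x}"
    using x by auto
  then have "card {y \<in> set xs. x \<le> y} + card {y \<in> set xs. y \<le> x} = length xs + 1"
    using card_Un_Int[of "{y \<in> set xs. x \<le> y}" "{y \<in> set xs. y \<le> x}"] assms(2)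
    by (simp add: distinct_card)
  then show "((\<lambda>x. card {y \<in> set (map f xs). y \<le> x}) \<circ> f) x =
      ((\<lambda>x. length xs + 1 - x) \<circ> (\<lambda>x. card {y \<in> set xs. y \<le> x})) x"
    using 1 by simp
qed

lemma standardize_append_sum:
  assumes "distinct xs" "\<And>x y. x \<in> set xs \<Longrightarrow> y \<in> set ys \<Longrightarrow> x < y"
  shows "standardize (xs @ ys) = standardize xs \<oplus>\<^sub>p standardize ys"
proof -
  have "card {v \<in> set (xs @ ys). v \<le> x} = card {v \<in> set xs. v \<le> x}" if "x \<in> set xs" for x
    using assms(2) that by (intro arg_cong[of _ _ card]) force
  moreover have "card {v \<in> set (xs @ ys). v \<le> y} = length xs + card {v \<in> set ys. v \<le> y}"
    if "y \<in> set ys" for y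
  proof -
    have "{v \<in> set (xs @ ys). v \<le> y} = set xs \<union> {v \<in> set ys. v \<le> y}" "set xs \<inter> {v \<in> set ys. v \<le> y} = {}"
      using assms(2) that by force+
    then show ?thesis using assms(1) by (simp add: card_Un_disjoint distinct_card)
  qed
  ultimately show ?thesis
    by (simp add: standardize_def direct_sum_def)
qed

lemma standardize_append_skew:
  assumes "distinct ys" "\<And>x y. x \<in> set xs \<Longrightarrow> y \<in> set ys \<Longrightarrow> y < x"
  shows "standardize (xs @ ys) = standardize xs \<ominus>\<^sub>p standardize ys"
proof -
  have "card {v \<in> set (xs @ ys). v \<le> y} = card {v \<in> set ys. v \<le> y}" if "y \<in> set ys" for y
    using assms(2) that by (intro arg_cong[of _ _ card]) force
  moreover have "card {v \<in> set (xs @ ys). v \<le> y} = length ys + card {v \<in> set xs. v \<le> y}"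
    if "y \<in> set xs" for y
  proof -
    have "{v \<in> set (xs @ ys). v \<le> y} = set ys \<union> {v \<in> set xs. v \<le> y}" "set ys \<inter> {v \<in> set xs. v \<le> y} = {}"
      using assms(2) that by force+
    then show ?thesis using assms(1) by (simp add: card_Un_disjoint distinct_card)
  qed
  ultimately show ?thesis
    by (simp add: standardize_def skew_sum_def)
qed

lemma is_perm_standardize: "distinct xs \<Longrightarrow> is_perm (standardize xs)"
proof (rule is_permI)
  assume d: "distinct xs"
  have "inj_on (\<lambda>x. card {y \<in> set xs. y \<le> x}) (set xs)"
  proof (rule linorder_inj_onI)
    fix x y assume "x < y" "x \<in> set xs" "y \<in> set xs"
    then have "{v \<in> set xs. v \<le> x} \<subset> {v \<in> set xs. v \<le> y}" by force
    then have "card {v \<in> set xs. v \<le> x} < card {v \<in> set xs. v \<le> y}" by (simp add: psubset_card_mono)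
    then show "card {v \<in> set xs. v \<le> x} \<noteq> card {v \<in> set xs. v \<le> y}" by simp
  qed auto
  then show "distinct (standardize xs)" using d by (simp add: standardize_def distinct_map)
  fix v assume "v \<in> set (standardize xs)"
  then obtain x where x: "x \<in> set xs" "v = card {y \<in> set xs. y \<le> x}" by (auto simp: standardize_def)
  then have "{y \<in> set xs. y \<le> x} \<noteq> {}" by auto
  then show "1 \<le> v \<and> v \<le> length (standardize xs)"
    using x card_le_bound[of xs x] by (simp add: Suc_le_eq card_gt_0_iff)
qed

lemma standardize_filter_sum:
  assumes "is_perm x" "is_perm y"
  shows "standardize (filter P (x \<oplus>\<^sub>p y)) =
    standardize (filter P x) \<oplus>\<^sub>p standardize (filter (\<lambda>v. P (length x + v)) y)"
proof -
  have "standardize (filter P (x \<oplus>\<^sub>p y)) =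
    standardize (filter P x @ map ((+) (length x)) (filter (\<lambda>v. P (length x + v)) y))"
    by (simp add: direct_sum_def filter_map comp_def)
  also have "\<dots> = standardize (filter P x) \<oplus>\<^sub>p standardize (map ((+) (length x)) (filter (\<lambda>v. P (length x + v)) y))"
    using assms is_perm_bounds[OF assms(1)] is_perm_bounds[OF assms(2)]
    by (intro standardize_append_sum) (force simp: is_perm_def)+
  also have "standardize (map ((+) (length x)) (filter (\<lambda>v. P (length x + v)) y)) =
      standardize (filter (\<lambda>v. P (length x + v)) y)"
    by (rule standardize_map_mono) (auto simp: strict_mono_on_def)
  finally show ?thesis .
qed

lemma standardize_filter_skew:
  assumes "is_perm x" "is_perm y"
  shows "standardize (filter P (x \<ominus>\<^sub>p y)) =
    standardize (filter (\<lambda>v. P (length y + v)) x) \<ominus>\<^sub>p standardize (filter P y)"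
proof -
  have "standardize (filter P (x \<ominus>\<^sub>p y)) =
    standardize (map ((+) (length y)) (filter (\<lambda>v. P (length y + v)) x) @ filter P y)"
    by (simp add: skew_sum_def filter_map comp_def)
  also have "\<dots> = standardize (map ((+) (length y)) (filter (\<lambda>v. P (length y + v)) x)) \<ominus>\<^sub>p standardize (filter P y)"
    using assms is_perm_bounds[OF assms(1)] is_perm_bounds[OF assms(2)]
    by (intro standardize_append_skew) (force simp: is_perm_def)+
  also have "standardize (map ((+) (length y)) (filter (\<lambda>v. P (length y + v)) x)) =
      standardize (filter (\<lambda>v. P (length y + v)) x)"
    by (rule standardize_map_mono) (auto simp: strict_mono_on_def)
  finally show ?thesis .
qed

lemma standardize_filter_complement:
  assumes "is_perm x"
  shows "standardize (filter P (complement x)) =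
    complement (standardize (filter (\<lambda>v. P (length x + 1 - v)) x))"
proof -
  have "standardize (filter P (complement x)) =
    standardize (map (\<lambda>v. length x + 1 - v) (filter (\<lambda>v. P (length x + 1 - v)) x))"
    by (simp add: complement_def filter_map comp_def)
  also have "\<dots> = complement (standardize (filter (\<lambda>v. P (length x + 1 - v)) x))"
    using assms is_perm_bounds[OF assms]
    by (intro standardize_map_antimono) (auto simp: monotone_on_def is_perm_def)
  finally show ?thesis .
qed

abbreviation evens :: "nat list \<Rightarrow> nat list" where
  "evens \<pi> \<equiv> standardize (filter even \<pi>)"

abbreviation odds :: "nat list \<Rightarrow> nat list" where
  "odds \<pi> \<equiv> standardize (filter odd \<pi>)"

text \<open>
  A summand of odd length shifts the other summand by an odd amount, which exchanges its even and
  odd entries.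
\<close>
lemma parts_sum:
  assumes "is_perm x" "is_perm y"
  shows "even (length x) \<Longrightarrow> evens (x \<oplus>\<^sub>p y) = evens x \<oplus>\<^sub>p evens y"
    and "even (length x) \<Longrightarrow> odds (x \<oplus>\<^sub>p y) = odds x \<oplus>\<^sub>p odds y"
    and "odd (length x) \<Longrightarrow> evens (x \<oplus>\<^sub>p y) = evens x \<oplus>\<^sub>p odds y"
    and "odd (length x) \<Longrightarrow> odds (x \<oplus>\<^sub>p y) = odds x \<oplus>\<^sub>p evens y"
  using standardize_filter_sum[OF assms, of even] standardize_filter_sum[OF assms, of odd] by simp_all

lemma parts_skew:
  assumes "is_perm x" "is_perm y"
  shows "even (length y) \<Longrightarrow> evens (x \<ominus>\<^sub>p y) = evens x \<ominus>\<^sub>p evens y"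
    and "even (length y) \<Longrightarrow> odds (x \<ominus>\<^sub>p y) = odds x \<ominus>\<^sub>p odds y"
    and "odd (length y) \<Longrightarrow> evens (x \<ominus>\<^sub>p y) = odds x \<ominus>\<^sub>p evens y"
    and "odd (length y) \<Longrightarrow> odds (x \<ominus>\<^sub>p y) = evens x \<ominus>\<^sub>p odds y"
  using standardize_filter_skew[OF assms, of even] standardize_filter_skew[OF assms, of odd] by simp_all

lemma parts_complement:
  assumes "is_perm x" "odd (length x)"
  shows "evens (complement x) = complement (evens x)" "odds (complement x) = complement (odds x)"
proof -
  have par: "even (length x + 1 - v) \<longleftrightarrow> even v" if "v \<in> set x" for v
  proof -
    have "v \<le> length x + 1" using is_perm_bounds[OF assms(1) that] by simp
    then show ?thesis using assms(2) by simp
  qed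
  have e: "filter (\<lambda>v. even (length x + 1 - v)) x = filter even x"
    "filter (\<lambda>v. odd (length x + 1 - v)) x = filter odd x"
    using par by (auto intro!: filter_cong)
  show "evens (complement x) = complement (evens x)" "odds (complement x) = complement (odds x)"
    using standardize_filter_complement[OF assms(1), of even] standardize_filter_complement[OF assms(1), of odd]
    unfolding e by simp_all
qed

lemma standardize_small: "standardize [] = []" "standardize [Suc 0] = [Suc 0]"
proof -
  have "{y. y = Suc 0 \<and> y \<le> Suc 0} = {Suc 0}" by auto
  then show "standardize [] = []" "standardize [Suc 0] = [Suc 0]" by (simp_all add: standardize_def)
qed

section \<open>From the grammar to snow leopards\<close>

definition Baxter_word :: "nat list \<Rightarrow> bool" where
  "Baxter_word w \<longleftrightarrow> is_perm w \<and> odd (length w) \<and>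
     (\<forall>i < length w. even (w ! i) \<longleftrightarrow> odd i) \<and>
     (\<forall>x < length w. \<forall>y < length w. \<forall>z < length w.
        w ! y = w ! x + 1 \<longrightarrow> x < z \<and> z < y \<or> y < z \<and> z < x \<longrightarrow>
        (odd (w ! x) \<longrightarrow> w ! z < w ! x) \<and> (even (w ! x) \<longrightarrow> w ! x + 1 < w ! z))"

lemma Baxter_wordD:
  assumes "Baxter_word w" "x < length w" "y < length w" "z < length w" "w ! y = w ! x + 1"
    "x < z \<and> z < y \<or> y < z \<and> z < x"
  shows "odd (w ! x) \<Longrightarrow> w ! z < w ! x" "even (w ! x) \<Longrightarrow> w ! x + 1 < w ! z"
  using assms unfolding Baxter_word_def by blast+

lemma complete_Baxter_if_Baxter_word:
  assumes "Baxter_word w"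
  shows "complete_Baxter w"
  unfolding complete_Baxter_def
proof (intro conjI)
  show "\<exists>n. w \<in> perms (2 * n + 1)"
    using assms by (auto simp: Baxter_word_def perms_iff elim: oddE)
  show "\<forall>i\<in>{1..length w}. even (entry w i) = even i"
    using assms by (auto simp: Baxter_word_def entry_def)
  show "\<forall>x\<in>{1..length w}. \<forall>y\<in>{1..length w}. \<forall>z\<in>{1..length w}. \<forall>i.
      entry w x = i \<and> entry w y = i + 1 \<and> (x < z \<and> z < y \<or> y < z \<and> z < x) \<longrightarrow>
      (odd i \<longrightarrow> entry w z < i) \<and> (even i \<longrightarrow> i + 1 < entry w z)"
  proof (intro ballI allI impI)
    fix x y z i
    assume r: "x \<in> {1..length w}" "y \<in> {1..length w}" "z \<in> {1..length w}"
      and h: "entry w x = i \<and> entry w y = i + 1 \<and> (x < z \<and> z < y \<or> y < z \<and> z < x)"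
    have "x - 1 < length w" "y - 1 < length w" "z - 1 < length w"
      "x - 1 < z - 1 \<and> z - 1 < y - 1 \<or> y - 1 < z - 1 \<and> z - 1 < x - 1" using r h by auto
    then show "(odd i \<longrightarrow> entry w z < i) \<and> (even i \<longrightarrow> i + 1 < entry w z)"
      using Baxter_wordD[OF assms, of "x - 1" "y - 1" "z - 1"] h by (auto simp: entry_def)
  qed
qed

lemma Baxter_word_one: "Baxter_word [1]"
  by (simp add: Baxter_word_def)

text \<open>
  Complementation reverses the order of the values and, as the length is odd, it exchanges the
  parities of the lower entries of the pairs \<open>i, i+1\<close>; these two effects cancel in the Baxter
  condition.
\<close>
lemma Baxter_word_complement:
  assumes "Baxter_word w"
  shows "Baxter_word (complement w)"
  unfolding Baxter_word_def length_sums
proof (intro conjI allI impI)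
  have p: "is_perm w" and o: "odd (length w)" using assms by (auto simp: Baxter_word_def)
  show "is_perm (complement w)" "odd (length w)" using p o by auto
  have par: "even (w ! i) \<longleftrightarrow> odd i" if "i < length w" for i using assms that by (auto simp: Baxter_word_def)
  note b = is_perm_nth_bounds[OF p]
  show "even (complement w ! i) \<longleftrightarrow> odd i" if "i < length w" for i
    using that b[OF that] par[OF that] o by (simp add: complement_nth)
  fix x y z
  assume r: "x < length w" "y < length w" "z < length w"
    and h: "complement w ! y = complement w ! x + 1" "x < z \<and> z < y \<or> y < z \<and> z < x"
  have e: "w ! x = w ! y + 1" using h r b[OF r(1)] b[OF r(2)] by (simp add: complement_nth) arith
  have pe: "even (complement w ! x) \<longleftrightarrow> odd (w ! y)"
    using e o b[OF r(1)] by (simp add: complement_nth r)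
  have h': "y < z \<and> z < x \<or> x < z \<and> z < y" using h by auto
  note D = Baxter_wordD[OF assms r(2,1,3) e h']
  show "odd (complement w ! x) \<Longrightarrow> complement w ! z < complement w ! x"
    using D(2) pe e b[OF r(3)] b[OF r(1)] by (simp add: complement_nth r)
  show "even (complement w ! x) \<Longrightarrow> complement w ! x + 1 < complement w ! z"
    using D(1) pe e b[OF r(3)] b[OF r(1)] b[OF r(2)] by (simp add: complement_nth r)
qed

lemma sum_one_nth:
  "i < length x \<Longrightarrow> (x \<oplus>\<^sub>p [1] \<oplus>\<^sub>p y) ! i = x ! i"
  "(x \<oplus>\<^sub>p [1] \<oplus>\<^sub>p y) ! length x = length x + 1"
  "i < length y \<Longrightarrow> (x \<oplus>\<^sub>p [1] \<oplus>\<^sub>p y) ! (length x + 1 + i) = length x + 1 + y ! i"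
  by (simp_all add: sum_nth)

lemma sum_one_cases:
  assumes "j < length (x \<oplus>\<^sub>p [1] \<oplus>\<^sub>p y)"
  obtains "j < length x" | "j = length x" | k where "j = length x + 1 + k" "k < length y"
  using assms le_Suc_ex[of "length x + 1" j] by force

text \<open>
  Only the two pairs of consecutive values that involve the middle entry are new. Its partner is
  the largest entry of \<open>x\<close> or the smallest entry of \<open>y\<close>, and everything in between belongs to the same
  summand as the partner.
\<close>
lemma Baxter_word_sum:
  assumes X: "Baxter_word x" and Y: "Baxter_word y"
  shows "Baxter_word (x \<oplus>\<^sub>p [1] \<oplus>\<^sub>p y)" (is "Baxter_word ?w")
  unfolding Baxter_word_def
proof (intro conjI allI impI)
  let ?m = "length x"
  have px: "is_perm x" "odd ?m" and py: "is_perm y" "odd (length y)"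
    using X Y by (auto simp: Baxter_word_def)
  then show "is_perm ?w" "odd (length ?w)" by auto
  fix i assume i: "i < length ?w"
  show "even (?w ! i) \<longleftrightarrow> odd i"
    using i
  proof (cases rule: sum_one_cases)
    case (3 k)
    have "even (y ! k) \<longleftrightarrow> odd k" using Y 3 by (simp add: Baxter_word_def)
    then show ?thesis unfolding 3(1) using 3 px by (simp add: sum_nth)
  qed (use X px in \<open>auto simp: sum_nth Baxter_word_def\<close>)
next
  let ?m = "length x"
  have px: "is_perm x" "odd ?m" and py: "is_perm y" "odd (length y)"
    using X Y by (auto simp: Baxter_word_def)
  note bx = is_perm_nth_bounds[OF px(1)] and ny = is_perm_nth_bounds[OF py(1)]
  note nths = sum_one_nth[simplified]
  fix a b c
  assume r: "a < length ?w" "b < length ?w" "c < length ?w" and s: "?w ! b = ?w ! a + 1"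
    and btw: "a < c \<and> c < b \<or> b < c \<and> c < a"
  have "(odd (?w ! a) \<longrightarrow> ?w ! c < ?w ! a) \<and> (even (?w ! a) \<longrightarrow> ?w ! a + 1 < ?w ! c)"
    using r(1)
  proof (rule sum_one_cases)
    assume a: "a < ?m"
    show ?thesis using r(2)
    proof (rule sum_one_cases)
      assume b: "b < ?m"
      then have c: "c < ?m" using a btw by auto
      show ?thesis using Baxter_wordD[OF X a b c] s btw a b c by (auto simp: nths)
    next
      assume b: "b = ?m"
      then have c: "c < ?m" "c \<noteq> a" using a btw by auto
      have "x ! a = ?m" using s a b by (simp add: nths)
      moreover have "x ! c \<noteq> x ! a" using c a px(1) by (simp add: is_perm_def nth_eq_iff_index_eq)
      ultimately show ?thesis using c a px(2) bx[OF c(1)] by (simp add: nths)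
    next
      fix k assume "b = ?m + 1 + k" "k < length y"
      then show ?thesis using s a bx[OF a] ny[of k] by (simp add: nths)
    qed
  next
    assume a: "a = ?m"
    show ?thesis using r(2)
    proof (rule sum_one_cases)
      assume b: "b < ?m"
      then show ?thesis using s a bx[OF b] by (simp add: nths)
    next
      assume "b = ?m" then show ?thesis using a s by simp
    next
      fix k assume b: "b = ?m + 1 + k" "k < length y"
      then have k1: "y ! k = 1" using s a by (simp add: nths)
      define l where "l = c - (?m + 1)"
      have l: "c = ?m + 1 + l" "l < length y" "l \<noteq> k" using btw a b by (auto simp: l_def)
      then have "y ! l \<noteq> y ! k" using b py(1) by (simp add: is_perm_def nth_eq_iff_index_eq)
      then show ?thesis using k1 ny[OF l(2)] l a px(2) by (simp add: nths)
    qed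
  next
    fix k assume a: "a = ?m + 1 + k" "k < length y"
    show ?thesis using r(2)
    proof (rule sum_one_cases)
      assume b: "b < ?m"
      then show ?thesis using s a bx[OF b] by (simp add: nths)
    next
      assume b: "b = ?m"
      then show ?thesis using s a ny[OF a(2)] by (simp add: nths)
    next
      fix j assume b: "b = ?m + 1 + j" "j < length y"
      define l where "l = c - (?m + 1)"
      have l: "c = ?m + 1 + l" "l < length y" "k < l \<and> l < j \<or> j < l \<and> l < k"
        using btw a b by (auto simp: l_def)
      have "y ! j = y ! k + 1" using s a b by (simp add: nths)
      then show ?thesis using Baxter_wordD[OF Y a(2) b(2) l(2) _ l(3)] a b l px(2) by (simp add: nths)
    qed
  qed
  then show "odd (?w ! a) \<Longrightarrow> ?w ! c < ?w ! a" "even (?w ! a) \<Longrightarrow> ?w ! a + 1 < ?w ! c" by auto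
qed

lemma Baxter_word_skew:
  assumes "Baxter_word x" "Baxter_word y"
  shows "Baxter_word (x \<ominus>\<^sub>p [1] \<ominus>\<^sub>p y)"
proof -
  have p: "is_perm x" "is_perm y" using assms by (auto simp: Baxter_word_def)
  have "Baxter_word (complement (complement x \<oplus>\<^sub>p [1] \<oplus>\<^sub>p complement y))"
    using assms Baxter_word_sum Baxter_word_complement by blast
  then show ?thesis using p by (simp add: complement_sum)
qed

text \<open>
  Doubly alternating permutations of even length, with the alternation of the inverse expressed by
  the positions of consecutive values. Even length is what makes skew sums alternate at the joint.
\<close>
definition alternating_word :: "nat list \<Rightarrow> bool" where
  "alternating_word \<beta> \<longleftrightarrow> is_perm \<beta> \<and> even (length \<beta>) \<and>
     (\<forall>i. i + 1 < length \<beta> \<longrightarrow> (if even i then \<beta> ! i < \<beta> ! (i + 1) else \<beta> ! (i + 1) < \<beta> ! i)) \<and>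
     (\<forall>x < length \<beta>. \<forall>y < length \<beta>. \<beta> ! y = \<beta> ! x + 1 \<longrightarrow> (if odd (\<beta> ! x) then x < y else y < x))"

lemma alternating_wordD:
  assumes "alternating_word \<beta>"
  shows "is_perm \<beta>" "even (length \<beta>)"
    "i + 1 < length \<beta> \<Longrightarrow> if even i then \<beta> ! i < \<beta> ! (i + 1) else \<beta> ! (i + 1) < \<beta> ! i"
    "x < length \<beta> \<Longrightarrow> y < length \<beta> \<Longrightarrow> \<beta> ! y = \<beta> ! x + 1 \<Longrightarrow> if odd (\<beta> ! x) then x < y else y < x"
  using assms unfolding alternating_word_def by blast+

lemma doubly_alternating_if_word:
  assumes A: "alternating_word \<beta>"
  shows "doubly_alternating \<beta>"
  unfolding doubly_alternating_def alternating_def length_perm_inverse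
proof (intro conjI ballI)
  note p = alternating_wordD(1)[OF A]
  fix i assume i: "i \<in> {1..<length \<beta>}"
  have "i - 1 + 1 < length \<beta>" "even (i - 1) \<longleftrightarrow> odd i" "i - 1 + 1 = i" using i by auto
  then show "odd i \<longrightarrow> entry \<beta> i < entry \<beta> (i + 1)" "even i \<longrightarrow> entry \<beta> (i + 1) < entry \<beta> i"
    using alternating_wordD(3)[OF A, of "i - 1"] by (auto simp: entry_def)
  have "i \<in> entry \<beta> ` {1..length \<beta>}" "i + 1 \<in> entry \<beta> ` {1..length \<beta>}"
    using i entry_bij[OF p] by (auto simp: bij_betw_def)
  then obtain x y where x: "x \<in> {1..length \<beta>}" "i = entry \<beta> x" and y: "y \<in> {1..length \<beta>}" "i + 1 = entry \<beta> y"
    by blast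
  have "x - 1 < length \<beta>" "y - 1 < length \<beta>" using x y by auto
  then have "if odd i then x < y else y < x"
    using alternating_wordD(4)[OF A, of "x - 1" "y - 1"] x y by (auto simp: entry_def split: if_splits)
  moreover have "entry (perm_inverse \<beta>) i = x" "entry (perm_inverse \<beta>) (i + 1) = y"
    using entry_perm_inverse[OF p x(1)] entry_perm_inverse[OF p y(1)] x y by simp_all
  ultimately show "odd i \<longrightarrow> entry (perm_inverse \<beta>) i < entry (perm_inverse \<beta>) (i + 1)"
    "even i \<longrightarrow> entry (perm_inverse \<beta>) (i + 1) < entry (perm_inverse \<beta>) i" by auto
qed

lemma alternating_word_Nil: "alternating_word []"
  by (simp add: alternating_word_def)

lemma alternating_word_skew:
  assumes A: "alternating_word x" and B: "alternating_word y"
  shows "alternating_word (x \<ominus>\<^sub>p y)" (is "alternating_word ?w")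
  unfolding alternating_word_def
proof (intro conjI allI impI)
  note a = alternating_wordD[OF A] and b = alternating_wordD[OF B]
  note bx = is_perm_nth_bounds[OF a(1)] and ny = is_perm_nth_bounds[OF b(1)]
  show "is_perm ?w" "even (length ?w)" using a(1,2) b(1,2) by auto
  show "if even i then ?w ! i < ?w ! (i + 1) else ?w ! (i + 1) < ?w ! i" if i: "i + 1 < length ?w" for i
  proof -
    consider "i + 1 < length x" | "i + 1 = length x" | "length x \<le> i" by atomize_elim arith
    then show ?thesis
    proof cases
      case 1
      then show ?thesis using a(3)[of i] by (auto simp: skew_nth split: if_splits)
    next
      case 2
      then have "odd i" using a(2) by presburger
      moreover have "?w ! (i + 1) = y ! 0" "?w ! i = length y + x ! i" "0 < length y"
        using 2 i by (auto simp: skew_nth)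
      ultimately show ?thesis using ny[of 0] bx[of i] 2 by simp
    next
      case 3
      then obtain k where "i = length x + k" using le_Suc_ex by blast
      then show ?thesis using b(3)[of k] a(2) i by (auto simp: skew_nth split: if_splits)
    qed
  qed
  fix i j assume i: "i < length ?w" and j: "j < length ?w" and s: "?w ! j = ?w ! i + 1"
  have split: thesis if "j < length ?w" "j < length x \<Longrightarrow> ?w ! j = length y + x ! j \<Longrightarrow> thesis"
    "\<And>k. j = length x + k \<Longrightarrow> k < length y \<Longrightarrow> ?w ! j = y ! k \<Longrightarrow> thesis" for j thesis
  proof (cases "j < length x")
    case True
    then show ?thesis using that by (simp add: skew_nth)
  next
    case False
    then obtain k where "j = length x + k" using le_Suc_ex[of "length x" j] by auto
    then show ?thesis using that by (simp add: skew_nth)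
  qed
  show "if odd (?w ! i) then i < j else j < i"
    using i
  proof (rule split)
    assume i: "i < length x" "?w ! i = length y + x ! i"
    show ?thesis using j
    proof (rule split)
      assume j: "j < length x" "?w ! j = length y + x ! j"
      then show ?thesis using a(4)[of i j] i s b(2) by simp
    next
      fix k assume "j = length x + k" "k < length y" "?w ! j = y ! k"
      then show ?thesis using ny[of k] i s by simp
    qed
  next
    fix k assume i: "i = length x + k" "k < length y" "?w ! i = y ! k"
    show ?thesis using j
    proof (rule split)
      assume j: "j < length x" "?w ! j = length y + x ! j"
      then have "y ! k = length y" using ny[OF i(2)] bx[OF j(1)] s i by simp
      then show ?thesis using i j b(2) by simp
    next
      fix l assume "j = length x + l" "l < length y" "?w ! j = y ! l"
      then show ?thesis using b(4)[of k l] i s by simp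
    qed
  qed
qed

lemma alternating_word_frame:
  assumes A: "alternating_word x"
  shows "alternating_word ([1] \<oplus>\<^sub>p complement x \<oplus>\<^sub>p [1])" (is "alternating_word ?w")
  unfolding alternating_word_def
proof (intro conjI allI impI)
  note a = alternating_wordD[OF A]
  note bx = is_perm_nth_bounds[OF a(1)]
  show "is_perm ?w" "even (length ?w)" using a(1,2) by auto
  have nth: "?w ! 0 = 1" "?w ! (length x + 1) = length x + 2"
    "\<And>k. k < length x \<Longrightarrow> ?w ! (k + 1) = length x + 2 - x ! k"
    using bx by (auto simp: sum_nth complement_nth Suc_diff_le le_SucI)
  have split: thesis if "j < length ?w" "j = 0 \<Longrightarrow> thesis" "j = length x + 1 \<Longrightarrow> thesis"
    "\<And>k. j = k + 1 \<Longrightarrow> k < length x \<Longrightarrow> thesis" for j thesis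
    using that by (cases j) force+
  show "if even i then ?w ! i < ?w ! (i + 1) else ?w ! (i + 1) < ?w ! i" if i: "i + 1 < length ?w" for i
  proof -
    consider "i = 0" "x = []" | "i = 0" "x \<noteq> []" | k where "i = k + 1" "k + 1 < length x"
      | k where "i = k + 1" "k + 1 = length x"
      using i by (cases i; cases "i < length x") auto
    then show ?thesis
    proof cases
      case 1
      then show ?thesis using nth(1,2) by simp
    next
      case 2
      then show ?thesis using nth(1) nth(3)[of 0] bx[of 0] by simp arith
    next
      case 3
      then show ?thesis using nth(3)[of k] nth(3)[of "k+1"] a(3)[of k] bx[of k] bx[of "k+1"]
        by (auto split: if_splits)
    next
      case 4
      then have "even i" "i = length x" using a(2) by auto
      then show ?thesis using nth(2) nth(3)[of k] bx[of k] 4 by simp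
    qed
  qed
  fix i j assume i: "i < length ?w" and j: "j < length ?w" and s: "?w ! j = ?w ! i + 1"
  show "if odd (?w ! i) then i < j else j < i"
    using i
  proof (rule split)
    assume i: "i = 0"
    show ?thesis using i s nth(1) by (cases "j = 0") auto
  next
    assume i: "i = length x + 1"
    show ?thesis using j by (rule split) (use i s nth bx in \<open>auto simp del: One_nat_def\<close>)
  next
    fix k assume i: "i = k + 1" "k < length x"
    then have wi: "?w ! i = length x + 2 - x ! k" using nth(3) by simp
    show ?thesis using j
    proof (rule split)
      assume "j = 0" then show ?thesis using s wi nth(1) bx[OF i(2)] by simp
    next
      assume "j = length x + 1"
      then have "x ! k = 1" using s wi nth(2) bx[OF i(2)] by simp
      then show ?thesis using i wi a(2) \<open>j = _\<close> by simp
    next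
      fix l assume j: "j = l + 1" "l < length x"
      then have wj: "?w ! j = length x + 2 - x ! l" using nth(3) by simp
      have "x ! k = x ! l + 1" using wi wj s bx[OF i(2)] bx[OF j(2)] by linarith
      moreover have "odd (?w ! i) \<longleftrightarrow> odd (x ! k)" using wi a(2) bx[OF i(2)] by simp
      ultimately show ?thesis using a(4)[of l k] i j by (auto split: if_splits)
    qed
  qed
qed

lemma frame_parts:
  assumes "is_perm x" "odd (length x)"
  shows "evens ([1] \<oplus>\<^sub>p complement x \<oplus>\<^sub>p [1]) = complement (odds x)"
    "odds ([1] \<oplus>\<^sub>p complement x \<oplus>\<^sub>p [1]) = [1] \<oplus>\<^sub>p complement (evens x) \<oplus>\<^sub>p [1]"
  using assms by (simp_all add: parts_sum parts_complement standardize_small)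

lemma skew_parts:
  assumes "is_perm x" "is_perm y" "odd (length x)" "odd (length y)"
  shows "evens (x \<ominus>\<^sub>p [1] \<ominus>\<^sub>p y) = evens x \<ominus>\<^sub>p [1] \<ominus>\<^sub>p evens y"
    "odds (x \<ominus>\<^sub>p [1] \<ominus>\<^sub>p y) = odds x \<ominus>\<^sub>p odds y"
  using assms by (simp_all add: parts_skew standardize_small)

text \<open>
  The witness for a frame is \<open>1 \<oplus> 1 \<oplus> c w \<oplus> 1 \<oplus> 1\<close>: the two inner new entries are even and frame
  the even entries of \<open>c w\<close>, and the two outer ones are odd and frame the odd entries. In
  \<open>v \<ominus> 1 \<ominus> w\<close> the middle entry is even, so the odd entries form a plain skew sum.
\<close>
lemma leopard_witness:
  "leopard \<sigma> \<Longrightarrow> \<exists>w. Baxter_word w \<and> length w = 2 * length \<sigma> + 1 \<and> evens w = \<sigma> \<and> alternating_word (odds w)"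
proof (induction rule: leopard.induct)
  case one
  have "Baxter_word ([1] \<oplus>\<^sub>p [1] \<oplus>\<^sub>p [1])" by (intro Baxter_word_sum Baxter_word_one)
  moreover have "evens ([1] \<oplus>\<^sub>p [1] \<oplus>\<^sub>p [1]) = [1]" "odds ([1] \<oplus>\<^sub>p [1] \<oplus>\<^sub>p [1]) = [1] \<oplus>\<^sub>p complement [] \<oplus>\<^sub>p [1]"
    by (simp_all add: parts_sum standardize_small)
  ultimately show ?case
    using alternating_word_frame[OF alternating_word_Nil]
    by (intro exI[of _ "[1] \<oplus>\<^sub>p [1] \<oplus>\<^sub>p [1]"]) (simp del: complement_small)
next
  case (frame x)
  then obtain w where w: "Baxter_word w" "length w = 2 * length x + 1" "evens w = x" "alternating_word (odds w)"
    by blast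
  let ?w = "[1] \<oplus>\<^sub>p [1] \<oplus>\<^sub>p complement w \<oplus>\<^sub>p [1] \<oplus>\<^sub>p [1]"
  have p: "is_perm w" "odd (length w)" using w(1) by (auto simp: Baxter_word_def)
  have "Baxter_word ?w"
    using w(1) by (intro Baxter_word_sum Baxter_word_one Baxter_word_complement)
  moreover have "evens ?w = [1] \<oplus>\<^sub>p complement x \<oplus>\<^sub>p [1]" "odds ?w = [1] \<oplus>\<^sub>p complement (odds w) \<oplus>\<^sub>p [1]"
    using p w(3) by (simp_all add: parts_sum parts_complement standardize_small)
  ultimately show ?case
    using alternating_word_frame[OF w(4)] w(2) by (intro exI[of _ ?w]) simp
next
  case (skew x y)
  then obtain v w where v: "Baxter_word v" "length v = 2 * length x + 1" "evens v = x" "alternating_word (odds v)"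
    and w: "Baxter_word w" "length w = 2 * length y + 1" "evens w = y" "alternating_word (odds w)"
    by blast
  have p: "is_perm v" "odd (length v)" "is_perm w" "odd (length w)"
    using v(1) w(1) by (auto simp: Baxter_word_def)
  show ?case
    using Baxter_word_skew[OF v(1) w(1)] skew_parts[OF p(1,3,2,4)] v w alternating_word_skew[OF v(4) w(4)]
    by (intro exI[of _ "v \<ominus>\<^sub>p [1] \<ominus>\<^sub>p w"]) simp
qed

proposition snow_leopard_iff_leopard:
  assumes "odd (length \<sigma>)"
  shows "snow_leopard (Perm \<sigma>) \<longleftrightarrow> leopard \<sigma>"
proof
  assume L: "leopard \<sigma>"
  then obtain w where "Baxter_word w" "length w = 2 * length \<sigma> + 1" "evens w = \<sigma>" "alternating_word (odds w)"
    using leopard_witness by blast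
  then show "snow_leopard (Perm \<sigma>)"
    using leopard_perm[OF L] complete_Baxter_if_Baxter_word doubly_alternating_if_word
    by (auto simp: perms_iff)
qed (use assms leopard_if_snow_leopard in blast)

section \<open>Entangled threads\<close>

text \<open>
  The pairs formed by the even and the odd thread of a snow leopard permutation of odd length; the
  rules come from applying the two operations of the grammar to the even and odd entries
  separately. Framing shifts the entries by one and so exchanges the two threads.
\<close>
inductive threads :: "nat list \<Rightarrow> nat list \<Rightarrow> bool" where
  one: "threads [] [1]"
| frame: "threads \<alpha> \<beta> \<Longrightarrow> threads (complement \<beta>) ([1] \<oplus>\<^sub>p complement \<alpha> \<oplus>\<^sub>p [1])"
| skew: "threads \<alpha> \<beta> \<Longrightarrow> threads \<alpha>' \<beta>' \<Longrightarrow> threads (\<alpha> \<ominus>\<^sub>p [1] \<ominus>\<^sub>p \<alpha>') (\<beta> \<ominus>\<^sub>p \<beta>')"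

lemma threads_iff: "threads \<alpha> \<beta> \<longleftrightarrow> (\<exists>\<sigma>. leopard \<sigma> \<and> evens \<sigma> = \<alpha> \<and> odds \<sigma> = \<beta>)"
proof
  show "threads \<alpha> \<beta> \<Longrightarrow> \<exists>\<sigma>. leopard \<sigma> \<and> evens \<sigma> = \<alpha> \<and> odds \<sigma> = \<beta>"
  proof (induction rule: threads.induct)
    case one
    then show ?case using leopard.one standardize_small by auto
  next
    case (frame \<alpha> \<beta>)
    then obtain \<sigma> where "leopard \<sigma>" "evens \<sigma> = \<alpha>" "odds \<sigma> = \<beta>" by blast
    then show ?case using leopard.frame frame_parts[of \<sigma>] leopard_perm by metis
  next
    case (skew \<alpha> \<beta> \<alpha>' \<beta>')
    then obtain \<sigma> \<sigma>' where "leopard \<sigma>" "evens \<sigma> = \<alpha>" "odds \<sigma> = \<beta>" "leopard \<sigma>'" "evens \<sigma>' = \<alpha>'" "odds \<sigma>' = \<beta>'"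
      by blast
    then show ?case using leopard.skew[of \<sigma> \<sigma>'] skew_parts[of \<sigma> \<sigma>'] leopard_perm by metis
  qed
next
  have "threads (evens \<sigma>) (odds \<sigma>)" if "leopard \<sigma>" for \<sigma>
    using that
  proof (induction rule: leopard.induct)
    case one
    then show ?case using threads.one by (simp add: standardize_small)
  next
    case (frame x)
    then show ?case using threads.frame frame_parts[of x] leopard_perm[of x] by metis
  next
    case (skew x y)
    then show ?case using threads.skew skew_parts[of x y] leopard_perm by metis
  qed
  then show "\<exists>\<sigma>. leopard \<sigma> \<and> evens \<sigma> = \<alpha> \<and> odds \<sigma> = \<beta> \<Longrightarrow> threads \<alpha> \<beta>" by blast
qed

lemma threads_perm: "threads \<alpha> \<beta> \<Longrightarrow> is_perm \<alpha> \<and> is_perm \<beta> \<and> length \<beta> = length \<alpha> + 1"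
  by (induction rule: threads.induct) auto

proposition entangled_iff_threads: "entangled (Perm \<alpha>) (Perm \<beta>) \<longleftrightarrow> threads \<alpha> \<beta>"
proof
  assume "entangled (Perm \<alpha>) (Perm \<beta>)"
  then obtain \<pi> where \<pi>: "snow_leopard \<pi>" "odd (xlength \<pi>)" "even_part \<pi> = Perm \<alpha>" "odd_part \<pi> = Perm \<beta>"
    by (auto simp: entangled_def)
  then obtain \<sigma> where "\<pi> = Perm \<sigma>" by (cases \<pi>) auto
  then show "threads \<alpha> \<beta>"
    using \<pi> snow_leopard_iff_leopard[of \<sigma>] unfolding threads_iff by (intro exI[of _ \<sigma>]) auto
next
  assume "threads \<alpha> \<beta>"
  then obtain \<sigma> where \<sigma>: "leopard \<sigma>" "evens \<sigma> = \<alpha>" "odds \<sigma> = \<beta>" using threads_iff by blast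
  then have "snow_leopard (Perm \<sigma>)" "odd (xlength (Perm \<sigma>))" "even_part (Perm \<sigma>) = Perm \<alpha>" "odd_part (Perm \<sigma>) = Perm \<beta>"
    using leopard_perm[of \<sigma>] snow_leopard_iff_leopard by auto
  then show "entangled (Perm \<alpha>) (Perm \<beta>)"
    unfolding entangled_def even_thread_def odd_thread_def by metis
qed

section \<open>Involutions that avoid 3412\<close>

definition avoids_3412 :: "nat list \<Rightarrow> bool" where
  "avoids_3412 \<tau> \<longleftrightarrow> (\<forall>i j k l. i < j \<and> j < k \<and> k < l \<and> l < length \<tau> \<longrightarrow>
     \<not> (\<tau> ! k < \<tau> ! l \<and> \<tau> ! l < \<tau> ! i \<and> \<tau> ! i < \<tau> ! j))"

lemma subseq_conv_indices:
  "subseq xs ys \<longleftrightarrow> (\<exists>is. sorted_wrt (<) is \<and> (\<forall>i \<in> set is. i < length ys) \<and> xs = map ((!) ys) is)"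
proof
  have nths: "nths ys N = map ((!) ys) (filter (\<lambda>i. i \<in> N) [0..<length ys])" for N
  proof -
    have "zip ys [0..<length ys] = map (\<lambda>i. (ys ! i, i)) [0..<length ys]"
      by (rule nth_equalityI) auto
    then show ?thesis by (simp add: nths_def filter_map comp_def)
  qed
  {
    assume "subseq xs ys"
    then obtain N where "xs = nths ys N" using subseq_conv_nths by metis
    then show "\<exists>is. sorted_wrt (<) is \<and> (\<forall>i \<in> set is. i < length ys) \<and> xs = map ((!) ys) is"
      unfolding nths by (intro exI[of _ "filter (\<lambda>i. i \<in> N) [0..<length ys]"]) (auto intro!: sorted_wrt_filter)
  next
    assume "\<exists>is. sorted_wrt (<) is \<and> (\<forall>i \<in> set is. i < length ys) \<and> xs = map ((!) ys) is"
    then obtain "is" where i: "sorted_wrt (<) is" "\<forall>i \<in> set is. i < length ys" "xs = map ((!) ys) is" by blast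
    have "filter (\<lambda>j. j \<in> set is) [0..<length ys] = is"
      using i(1,2) by (intro sorted_distinct_set_unique sorted_wrt_filter)
        (auto simp: strict_sorted_iff sorted_wrt_filter)
    then show "subseq xs ys" using i(3) nths[of "set is"] subseq_conv_nths by metis
  }
qed

lemma standardize_3412_iff:
  "standardize [a, b, c, d] = [3, 4, 1, 2] \<longleftrightarrow> c < d \<and> d < a \<and> a < b"
proof
  let ?r = "\<lambda>x. card {y \<in> set [a, b, c, d]. y \<le> x}"
  have mono: "?r x < ?r y \<Longrightarrow> x < y" for x y
  proof (rule ccontr)
    assume "?r x < ?r y" "\<not> x < y"
    moreover have "?r y \<le> ?r x" using \<open>\<not> x < y\<close> by (intro card_mono) auto
    ultimately show False by simp
  qed
  assume "standardize [a, b, c, d] = [3, 4, 1, 2]"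
  then have "?r a = 3" "?r b = 4" "?r c = 1" "?r d = 2" by (simp_all add: standardize_def)
  then show "c < d \<and> d < a \<and> a < b" using mono[of c d] mono[of d a] mono[of a b] by simp
next
  assume o: "c < d \<and> d < a \<and> a < b"
  then have "{y \<in> set [a, b, c, d]. y \<le> a} = {c, d, a}" "{y \<in> set [a, b, c, d]. y \<le> b} = {c, d, a, b}"
    "{y \<in> set [a, b, c, d]. y \<le> c} = {c}" "{y \<in> set [a, b, c, d]. y \<le> d} = {c, d}" by auto
  then show "standardize [a, b, c, d] = [3, 4, 1, 2]" using o unfolding standardize_def by simp
qed

lemma avoids_3412_iff: "avoids [3, 4, 1, 2] \<tau> \<longleftrightarrow> avoids_3412 \<tau>"
proof -
  have "(\<exists>xs. subseq xs \<tau> \<and> standardize xs = [3, 4, 1, 2]) \<longleftrightarrow>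
    (\<exists>i j k l. i < j \<and> j < k \<and> k < l \<and> l < length \<tau> \<and> \<tau> ! k < \<tau> ! l \<and> \<tau> ! l < \<tau> ! i \<and> \<tau> ! i < \<tau> ! j)"
  proof (intro iffI; elim exE conjE)
    fix xs assume s: "subseq xs \<tau>" "standardize xs = [3, 4, 1, 2]"
    then obtain "is" where i: "sorted_wrt (<) is" "\<forall>i \<in> set is. i < length \<tau>" "xs = map ((!) \<tau>) is"
      using subseq_conv_indices by blast
    have "length is = 4" using arg_cong[OF s(2), of length] i(3) by simp
    then obtain i j k l where "is = [i, j, k, l]" by (auto simp: length_Suc_conv numeral_eq_Suc)
    then show "\<exists>i j k l. i < j \<and> j < k \<and> k < l \<and> l < length \<tau> \<and> \<tau> ! k < \<tau> ! l \<and> \<tau> ! l < \<tau> ! i \<and> \<tau> ! i < \<tau> ! j"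
      using i s(2) standardize_3412_iff by (intro exI[of _ i] exI[of _ j] exI[of _ k] exI[of _ l]) auto
  next
    fix i j k l
    assume o: "i < j" "j < k" "k < l" "l < length \<tau>" "\<tau> ! k < \<tau> ! l" "\<tau> ! l < \<tau> ! i" "\<tau> ! i < \<tau> ! j"
    have "subseq [\<tau> ! i, \<tau> ! j, \<tau> ! k, \<tau> ! l] \<tau>"
      unfolding subseq_conv_indices using o by (intro exI[of _ "[i, j, k, l]"]) auto
    then show "\<exists>xs. subseq xs \<tau> \<and> standardize xs = [3, 4, 1, 2]" using standardize_3412_iff o by blast
  qed
  then show ?thesis unfolding avoids_def avoids_3412_def by blast
qed

definition involution_word :: "nat list \<Rightarrow> bool" where
  "involution_word \<tau> \<longleftrightarrow> is_perm \<tau> \<and> (\<forall>i < length \<tau>. \<tau> ! (\<tau> ! i - 1) = i + 1)"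

lemma involution_iff:
  assumes "is_perm \<tau>"
  shows "involution \<tau> \<longleftrightarrow> involution_word \<tau>"
proof
  assume inv: "involution \<tau>"
  have "\<tau> ! (\<tau> ! i - 1) = i + 1" if "i < length \<tau>" for i
    using entry_perm_inverse[OF assms, of "i + 1"] inv that by (simp add: involution_def entry_def)
  then show "involution_word \<tau>" using assms by (simp add: involution_word_def)
next
  assume w: "involution_word \<tau>"
  have "perm_inverse \<tau> ! i = \<tau> ! i" if "i < length \<tau>" for i
  proof -
    have "entry \<tau> (\<tau> ! i) = i + 1" using w that by (simp add: involution_word_def entry_def)
    then show ?thesis
      using entry_perm_inverse[OF assms, of "\<tau> ! i"] is_perm_nth_bounds[OF assms that] by (simp add: entry_def)
  qed
  then show "involution \<tau>" unfolding involution_def by (intro nth_equalityI) auto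
qed

definition avoiding_involution :: "nat list \<Rightarrow> bool" where
  "avoiding_involution \<tau> \<longleftrightarrow> involution_word \<tau> \<and> avoids_3412 \<tau>"

lemma avoiding_involution_perm: "avoiding_involution \<tau> \<Longrightarrow> is_perm \<tau>"
  by (simp add: avoiding_involution_def involution_word_def)

lemma avoiding_involution_Nil: "avoiding_involution []" and avoiding_involution_one: "avoiding_involution [1]"
  by (auto simp: avoiding_involution_def involution_word_def avoids_3412_def)

lemma involution_word_sum_iff:
  assumes "is_perm x" "is_perm y"
  shows "involution_word (x \<oplus>\<^sub>p y) \<longleftrightarrow> involution_word x \<and> involution_word y"
proof -
  have x: "(x \<oplus>\<^sub>p y) ! ((x \<oplus>\<^sub>p y) ! i - 1) = x ! (x ! i - 1)" if "i < length x" for i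
  proof -
    have "x ! i - 1 < length x" using is_perm_nth_bounds[OF assms(1) that] by linarith
    then show ?thesis using that by (simp add: sum_nth)
  qed
  have y: "(x \<oplus>\<^sub>p y) ! ((x \<oplus>\<^sub>p y) ! (length x + i) - 1) = length x + y ! (y ! i - 1)" if "i < length y" for i
  proof -
    have v: "length x + y ! i - 1 = length x + (y ! i - 1)" "y ! i - 1 < length y"
      using is_perm_nth_bounds[OF assms(2) that] by linarith+
    have "(x \<oplus>\<^sub>p y) ! (length x + i) = length x + y ! i" using that by (simp add: sum_nth)
    then show ?thesis unfolding v(1)[symmetric] using v by (simp add: sum_nth)
  qed
  have "(\<forall>i < length (x \<oplus>\<^sub>p y). (x \<oplus>\<^sub>p y) ! ((x \<oplus>\<^sub>p y) ! i - 1) = i + 1) \<longleftrightarrow>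
    (\<forall>i < length x. x ! (x ! i - 1) = i + 1) \<and> (\<forall>i < length y. y ! (y ! i - 1) = i + 1)" (is "?l \<longleftrightarrow> ?r")
  proof
    assume l: ?l
    show ?r
    proof (intro conjI allI impI)
      fix i assume "i < length x"
      then show "x ! (x ! i - 1) = i + 1" using l x[of i] by simp
    next
      fix i assume "i < length y"
      then show "y ! (y ! i - 1) = i + 1" using l[rule_format, of "length x + i"] y[of i] by simp
    qed
  next
    assume r: ?r
    show ?l
    proof (intro allI impI)
      fix i assume i: "i < length (x \<oplus>\<^sub>p y)"
      show "(x \<oplus>\<^sub>p y) ! ((x \<oplus>\<^sub>p y) ! i - 1) = i + 1"
      proof (cases "i < length x")
        case True
        then show ?thesis using r x by simp
      next
        case False
        then obtain k where "i = length x + k" using le_Suc_ex[of "length x" i] by auto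
        then show ?thesis using r y[of k] i by simp
      qed
    qed
  qed
  then show ?thesis using assms by (simp add: involution_word_def)
qed

lemma avoids_3412_sum_iff:
  assumes "is_perm x" "is_perm y"
  shows "avoids_3412 (x \<oplus>\<^sub>p y) \<longleftrightarrow> avoids_3412 x \<and> avoids_3412 y"
proof -
  let ?w = "x \<oplus>\<^sub>p y"
  have lo: "?w ! i = x ! i" "x ! i \<le> length x" if "i < length x" for i
    using that is_perm_nth_bounds[OF assms(1) that] by (auto simp: sum_nth)
  have hi: "?w ! (length x + i) = length x + y ! i" "1 \<le> y ! i" if "i < length y" for i
    using that is_perm_nth_bounds[OF assms(2) that] by (auto simp: sum_nth)
  have big: "length x < ?w ! i" if "length x \<le> i" "i < length x + length y" for i
  proof -
    have "i - length x < length y" "i = length x + (i - length x)" using that by linarith+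
    then show ?thesis using hi[of "i - length x"] by simp
  qed
  show ?thesis
  proof (intro iffI conjI)
    assume w: "avoids_3412 ?w"
    show "avoids_3412 x" unfolding avoids_3412_def
    proof (intro allI impI)
      fix i j k l assume o: "i < j \<and> j < k \<and> k < l \<and> l < length x"
      then show "\<not> (x ! k < x ! l \<and> x ! l < x ! i \<and> x ! i < x ! j)"
        using w[unfolded avoids_3412_def, rule_format, of i j k l] lo by auto
    qed
    show "avoids_3412 y" unfolding avoids_3412_def
    proof (intro allI impI)
      fix i j k l assume o: "i < j \<and> j < k \<and> k < l \<and> l < length y"
      then show "\<not> (y ! k < y ! l \<and> y ! l < y ! i \<and> y ! i < y ! j)"
        using w[unfolded avoids_3412_def, rule_format, of "length x + i" "length x + j" "length x + k" "length x + l"] hi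
        by auto
    qed
  next
    assume xy: "avoids_3412 x \<and> avoids_3412 y"
    show "avoids_3412 ?w" unfolding avoids_3412_def
    proof (intro allI impI notI)
      fix i j k l assume o: "i < j \<and> j < k \<and> k < l \<and> l < length ?w"
        and p: "?w ! k < ?w ! l \<and> ?w ! l < ?w ! i \<and> ?w ! i < ?w ! j"
      show False
      proof (cases "i < length x")
        case True
        then have "l < length x" using p o lo[of i] big[of l] by fastforce
        then show ?thesis using xy[THEN conjunct1, unfolded avoids_3412_def, rule_format, of i j k l] o p lo by auto
      next
        case False
        define i' j' k' l' where d: "i' = i - length x" "j' = j - length x" "k' = k - length x" "l' = l - length x"
        then have e: "i = length x + i'" "j = length x + j'" "k = length x + k'" "l = length x + l'" using False o by auto
        then have o': "i' < j' \<and> j' < k' \<and> k' < l' \<and> l' < length y" using o by auto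
        then show ?thesis
          using xy[THEN conjunct2, unfolded avoids_3412_def, rule_format, OF o'] p hi unfolding e by auto
      qed
    qed
  qed
qed

lemma avoiding_involution_sum_iff: "is_perm x \<Longrightarrow> is_perm y \<Longrightarrow> avoiding_involution (x \<oplus>\<^sub>p y) \<longleftrightarrow> avoiding_involution x \<and> avoiding_involution y"
  by (auto simp: avoiding_involution_def involution_word_sum_iff avoids_3412_sum_iff)

lemma avoiding_involution_frame_iff:
  assumes p: "is_perm x"
  shows "avoiding_involution ([1] \<ominus>\<^sub>p x \<ominus>\<^sub>p [1]) \<longleftrightarrow> avoiding_involution x"
proof -
  let ?w = "[1] \<ominus>\<^sub>p x \<ominus>\<^sub>p [1]"
  note b = is_perm_nth_bounds[OF p]
  have n: "?w ! 0 = length x + 2" "?w ! (length x + 1) = 1" "\<And>i. i < length x \<Longrightarrow> ?w ! (i + 1) = x ! i + 1"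
    by (auto simp: skew_nth)
  have le: "?w ! i \<le> length x + 2" "1 \<le> ?w ! i" if "i < length x + 2" for i
    using is_perm_nth_bounds[of ?w i] p that by auto
  have "involution_word ?w \<longleftrightarrow> involution_word x"
  proof -
    have mid: "?w ! (?w ! (i + 1) - 1) = i + 2 \<longleftrightarrow> x ! (x ! i - 1) = i + 1" if "i < length x" for i
    proof -
      have "x ! i - 1 < length x" "x ! i = (x ! i - 1) + 1" using b[OF that] by linarith+
      then have "?w ! (x ! i) = x ! (x ! i - 1) + 1" using n(3)[of "x ! i - 1"] by simp
      then show ?thesis using n(3)[OF that] by simp
    qed
    have ends: "?w ! (?w ! 0 - 1) = 1" "?w ! (?w ! (length x + 1) - 1) = length x + 2"
      using n(1,2) by simp_all
    have "(\<forall>i < length ?w. ?w ! (?w ! i - 1) = i + 1) \<longleftrightarrow> (\<forall>i < length x. x ! (x ! i - 1) = i + 1)"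
    proof (intro iffI allI impI)
      fix i assume "\<forall>i < length ?w. ?w ! (?w ! i - 1) = i + 1" "i < length x"
      then show "x ! (x ! i - 1) = i + 1" using mid[of i] by auto
    next
      fix i assume h: "\<forall>i < length x. x ! (x ! i - 1) = i + 1" and "i < length ?w"
      then consider "i = 0" | "i = length x + 1" | j where "i = j + 1" "j < length x" by (cases i) force+
      then show "?w ! (?w ! i - 1) = i + 1" using ends mid h by cases auto
    qed
    then show ?thesis using p by (simp add: involution_word_def)
  qed
  moreover have "avoids_3412 ?w \<longleftrightarrow> avoids_3412 x"
  proof
    assume w: "avoids_3412 ?w"
    show "avoids_3412 x" unfolding avoids_3412_def
    proof (intro allI impI)
      fix i j k l assume o: "i < j \<and> j < k \<and> k < l \<and> l < length x"
      then show "\<not> (x ! k < x ! l \<and> x ! l < x ! i \<and> x ! i < x ! j)"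
        using w[unfolded avoids_3412_def, rule_format, of "i+1" "j+1" "k+1" "l+1"] n(3)[of i] n(3)[of j] n(3)[of k] n(3)[of l]
        by auto
    qed
  next
    assume x: "avoids_3412 x"
    show "avoids_3412 ?w" unfolding avoids_3412_def
    proof (intro allI impI notI)
      fix i j k l assume o: "i < j \<and> j < k \<and> k < l \<and> l < length ?w"
        and q: "?w ! k < ?w ! l \<and> ?w ! l < ?w ! i \<and> ?w ! i < ?w ! j"
      have "i \<noteq> 0" using q o n(1) le(1)[of j] by (intro notI) simp
      moreover have "l \<noteq> length x + 1" using q o n(2) le(2)[of k] by (intro notI) simp
      moreover define i' j' k' l' where "i' = i - 1" "j' = j - 1" "k' = k - 1" "l' = l - 1"
      ultimately have e: "i = i' + 1" "j = j' + 1" "k = k' + 1" "l = l' + 1"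
        and o': "i' < j' \<and> j' < k' \<and> k' < l' \<and> l' < length x" using o by auto
      show False
        using x[unfolded avoids_3412_def, rule_format, OF o'] q n(3)[of i'] n(3)[of j'] n(3)[of k'] n(3)[of l'] o'
        unfolding e by auto
    qed
  qed
  ultimately show ?thesis by (simp add: avoiding_involution_def)
qed

text \<open>
  Let \<open>\<tau>\<close> start with \<open>k\<close>, so that the value \<open>1\<close> is in position \<open>k\<close>. A position \<open>i < k\<close> with
  \<open>\<tau>(i) > k\<close> would yield the pattern \<open>3412\<close> in the positions \<open>1, i, k, \<tau>(i)\<close>, whose entries are
  \<open>k, \<tau>(i), 1, i\<close>. Hence the first \<open>k\<close> entries form a summand.
\<close>
lemma avoiding_involution_cases:
  assumes g: "avoiding_involution \<tau>" and ne: "\<tau> \<noteq> []"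
  obtains y where "avoiding_involution y" "\<tau> = [1] \<oplus>\<^sub>p y"
  | x y where "avoiding_involution x" "avoiding_involution y" "\<tau> = ([1] \<ominus>\<^sub>p x \<ominus>\<^sub>p [1]) \<oplus>\<^sub>p y"
proof -
  have p: "is_perm \<tau>" using g avoiding_involution_perm by blast
  have inv: "\<tau> ! (\<tau> ! i - 1) = i + 1" if "i < length \<tau>" for i
    using g that by (auto simp: avoiding_involution_def involution_word_def)
  note b = is_perm_nth_bounds[OF p]
  define k where "k = \<tau> ! 0"
  have k: "1 \<le> k" "k \<le> length \<tau>" using b[of 0] ne by (auto simp: k_def)
  have k1: "\<tau> ! (k - 1) = 1" using inv[of 0] ne by (simp add: k_def)
  have "\<tau> ! i \<le> k" if i: "i < k" for i
  proof (rule ccontr)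
    assume neg: "\<not> \<tau> ! i \<le> k"
    then have "0 < i" by (cases "i = 0") (auto simp: k_def)
    moreover have "i \<noteq> k - 1" using neg k1 k by auto
    \<comment> \<open>Indices are zero-based here: position \<open>v\<close> of the one-line notation has index \<open>v - 1\<close>.\<close>
    ultimately have "0 < i \<and> i < k - 1 \<and> k - 1 < \<tau> ! i - 1 \<and> \<tau> ! i - 1 < length \<tau>"
      using neg i b[of i] k by auto
    moreover have "\<tau> ! (\<tau> ! i - 1) = i + 1" using inv[of i] i k by simp
    ultimately show False
      using g[unfolded avoiding_involution_def avoids_3412_def, THEN conjunct2, rule_format, of 0 i "k - 1" "\<tau> ! i - 1"] k1 neg
      by (auto simp: k_def)
  qed
  then obtain u y where u: "is_perm u" "is_perm y" "length u = k" "\<tau> = u \<oplus>\<^sub>p y"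
    using initial_block[OF p k(2)] by blast
  have gu: "avoiding_involution u" "avoiding_involution y" using g avoiding_involution_sum_iff u by auto
  show thesis
  proof (cases "k = 1")
    case True
    then show ?thesis using that(1)[of y] gu u is_perm_length_1 by auto
  next
    case False
    have \<tau>u: "\<tau> ! i = u ! i" if "i < k" for i using that u(3) unfolding u(4) by (simp add: sum_nth)
    have u0: "u ! 0 = k" "u ! (k - 1) = 1"
      using \<tau>u[of 0] \<tau>u[of "k - 1"] k k1 k_def[symmetric] by simp_all
    have "length u - 1 < u ! i" if "i < 1" for i using that u0 u k by simp
    then obtain h r where h: "is_perm h" "is_perm r" "length h = 1" "u = h \<ominus>\<^sub>p r"
      using initial_block_skew[OF u(1), of 1] u k by auto
    have lr: "length r = k - 1" using h u by auto
    have rl: "r ! (k - 2) = 1" using u0(2) h lr False k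
      by (auto simp: skew_nth numeral_2_eq_2)
    have big: "length r - (k - 2) < r ! i" if "i < k - 2" for i
    proof -
      have "r ! i \<noteq> r ! (k - 2)" using h(2) lr that by (simp add: is_perm_def nth_eq_iff_index_eq)
      moreover have "length r - (k - 2) = 1" "1 \<le> r ! i"
        using is_perm_nth_bounds[OF h(2), of i] that lr False k by auto
      ultimately show ?thesis using rl by linarith
    qed
    have kr: "k - 2 \<le> length r" using lr by simp
    obtain x t where x: "is_perm x" "is_perm t" "length x = k - 2" "r = x \<ominus>\<^sub>p t"
      using initial_block_skew[OF h(2) kr big] by blast
    have "length t = 1" using lr x False k by auto
    then have "u = [1] \<ominus>\<^sub>p x \<ominus>\<^sub>p [1]" using h x is_perm_length_1 by auto
    then show ?thesis using that(2)[of x y] gu u x avoiding_involution_frame_iff by auto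
  qed
qed

definition co_avoiding_involution :: "nat list \<Rightarrow> bool" where
  "co_avoiding_involution \<beta> \<longleftrightarrow> is_perm \<beta> \<and> avoiding_involution (complement \<beta>)"

lemma co_involution_3412_iff: "co_involution_3412 n \<beta> \<longleftrightarrow> co_avoiding_involution \<beta> \<and> length \<beta> = n"
proof
  assume "co_involution_3412 n \<beta>"
  then show "co_avoiding_involution \<beta> \<and> length \<beta> = n"
    by (auto simp: co_involution_3412_def co_avoiding_involution_def avoiding_involution_def perms_iff involution_iff avoids_3412_iff[simplified])
next
  assume "co_avoiding_involution \<beta> \<and> length \<beta> = n"
  then show "co_involution_3412 n \<beta>"
    unfolding co_involution_3412_def
    by (intro bexI[of _ "complement \<beta>"])
      (auto simp: co_avoiding_involution_def avoiding_involution_def perms_iff involution_iff avoids_3412_iff[simplified])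
qed

lemma co_avoiding_involution_Nil: "co_avoiding_involution []" and co_avoiding_involution_one: "co_avoiding_involution [1]"
  using avoiding_involution_Nil avoiding_involution_one by (simp_all add: co_avoiding_involution_def)

lemma co_avoiding_involution_skew: "co_avoiding_involution x \<Longrightarrow> co_avoiding_involution y \<Longrightarrow> co_avoiding_involution (x \<ominus>\<^sub>p y)"
  by (auto simp: co_avoiding_involution_def complement_skew avoiding_involution_sum_iff)

lemma co_avoiding_involution_frame: "co_avoiding_involution x \<Longrightarrow> co_avoiding_involution ([1] \<oplus>\<^sub>p x \<oplus>\<^sub>p [1])"
  using avoiding_involution_frame_iff[of "complement x"] by (auto simp: co_avoiding_involution_def complement_sum)

lemma co_avoiding_involution_cases:
  assumes "co_avoiding_involution \<beta>" "\<beta> \<noteq> []"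
  obtains y where "co_avoiding_involution y" "\<beta> = [1] \<ominus>\<^sub>p y"
  | x y where "co_avoiding_involution x" "co_avoiding_involution y" "\<beta> = ([1] \<oplus>\<^sub>p x \<oplus>\<^sub>p [1]) \<ominus>\<^sub>p y"
proof -
  have p: "is_perm \<beta>" "avoiding_involution (complement \<beta>)" "complement \<beta> \<noteq> []" using assms by (auto simp: co_avoiding_involution_def)
  from p(2,3) show thesis
  proof (cases rule: avoiding_involution_cases)
    case (1 y)
    then have "\<beta> = [1] \<ominus>\<^sub>p complement y" using p(1) avoiding_involution_perm by (simp add: complement_eq_iff complement_sum)
    then show ?thesis using that(1)[of "complement y"] 1 avoiding_involution_perm by (simp add: co_avoiding_involution_def)
  next
    case (2 x y)
    then have "\<beta> = ([1] \<oplus>\<^sub>p complement x \<oplus>\<^sub>p [1]) \<ominus>\<^sub>p complement y"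
      using p(1) avoiding_involution_perm by (simp add: complement_eq_iff complement_sum complement_skew)
    then show ?thesis using that(2)[of "complement x" "complement y"] 2 avoiding_involution_perm by (simp add: co_avoiding_involution_def)
  qed
qed

section \<open>Layered even threads\<close>

lemma skew_decreasing: "decreasing (m + n) = decreasing m \<ominus>\<^sub>p decreasing n"
  using skew_eq_decreasing_iff[of "decreasing m" "decreasing n" "m + n"] by simp

lemma threads_decreasing_frame:
  assumes "threads (decreasing n) \<beta>"
  shows "threads (complement \<beta>) (increasing (n + 2))"
    "threads (decreasing (n + 2)) ([1] \<oplus>\<^sub>p \<beta> \<oplus>\<^sub>p [1])"
proof -
  have "[1] \<oplus>\<^sub>p increasing n \<oplus>\<^sub>p [1] = increasing (n + 2)"
    using sum_eq_increasing_iff[of "[1]" "increasing n \<oplus>\<^sub>p [1]"] sum_eq_increasing_iff[of "increasing n" "[1]"]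
    by (simp add: increasing_1)
  then show 1: "threads (complement \<beta>) (increasing (n + 2))"
    using threads.frame[OF assms] by simp
  show "threads (decreasing (n + 2)) ([1] \<oplus>\<^sub>p \<beta> \<oplus>\<^sub>p [1])"
    using threads.frame[OF 1] threads_perm[OF assms] by simp
qed

lemma threads_co_avoiding_involution: "co_avoiding_involution \<beta> \<Longrightarrow> \<beta> \<noteq> [] \<Longrightarrow> threads (decreasing (length \<beta> - 1)) \<beta>"
proof (induction "length \<beta>" arbitrary: \<beta> rule: less_induct)
  case less
  have join: "threads (decreasing (length \<beta> - 1)) \<beta>"
    if h: "threads (decreasing (length h - 1)) h" and y: "co_avoiding_involution y" and eq: "\<beta> = h \<ominus>\<^sub>p y" for h y
  proof (cases "y = []")
    case True
    then show ?thesis using h eq by simp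
  next
    case False
    have hl: "length h > 0" using threads_perm[OF h] by (cases h) simp_all
    then have "threads (decreasing (length y - 1)) y" using less.hyps[of y] y False eq by simp
    from threads.skew[OF h this]
    have "threads (decreasing (length h - 1) \<ominus>\<^sub>p decreasing 1 \<ominus>\<^sub>p decreasing (length y - 1)) \<beta>"
      using eq by (simp add: decreasing_1)
    moreover have "length h - 1 + (1 + (length y - 1)) = length \<beta> - 1" using eq hl False by (cases y) auto
    ultimately show ?thesis by (metis skew_decreasing)
  qed
  from less.prems show ?case
  proof (cases rule: co_avoiding_involution_cases)
    case (1 y)
    then show ?thesis using join[of "[1]" y] threads.one by (simp add: decreasing_1)
  next
    case (2 x y)
    have "threads (decreasing (length x + 1)) ([1] \<oplus>\<^sub>p x \<oplus>\<^sub>p [1])"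
    proof (cases "x = []")
      case True
      then show ?thesis using threads.frame[OF threads.one] by (simp add: decreasing_1)
    next
      case False
      then have "threads (decreasing (length x - 1)) x" using less.hyps[of x] 2 by simp
      from threads_decreasing_frame(2)[OF this] show ?thesis using False by (cases x) auto
    qed
    then show ?thesis using join[of "[1] \<oplus>\<^sub>p x \<oplus>\<^sub>p [1]" y] 2 by simp
  qed
qed

text \<open>
  An increasing odd thread of length at least two is not a skew sum, so it arises by
  framing a decreasing even thread.
\<close>
lemma threads_increasing:
  assumes "threads \<alpha> (increasing m)"
  shows "\<alpha> = [] \<and> m = 1 \<or> (\<exists>\<beta>. \<alpha> = complement \<beta> \<and> 2 \<le> m \<and> threads (decreasing (m - 2)) \<beta>)"
  using assms
proof (cases rule: threads.cases)
  case one
  have "m = 1" using arg_cong[OF one(2), of length] by simp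
  then show ?thesis using one(1) by blast
next
  case (frame \<alpha>' \<beta>)
  then have "complement \<alpha>' = increasing (length \<alpha>')" "m = length \<alpha>' + 2"
    by (simp_all add: eq_commute[of "increasing m"] sum_eq_increasing_iff)
  moreover have "is_perm \<alpha>'" using threads_perm[OF frame(3)] by simp
  ultimately show ?thesis using frame by (auto simp: complement_eq_iff)
next
  case (skew \<alpha>1 \<beta>1 \<alpha>2 \<beta>2)
  note p = threads_perm[OF skew(3)] threads_perm[OF skew(4)]
  have "m = length \<beta>1 + length \<beta>2" using arg_cong[OF skew(2), of length] by simp
  then have "m = 1 + (m - 1)" "increasing (m - 1) \<noteq> []" using p by (auto simp flip: length_0_conv)
  then have "increasing 1 \<oplus>\<^sub>p increasing (m - 1) = \<beta>1 \<ominus>\<^sub>p \<beta>2" using skew(2) increasing_add by metis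
  moreover have "\<beta>1 \<noteq> []" "\<beta>2 \<noteq> []" using p by auto
  ultimately show ?thesis
    using sum_neq_skew[of "increasing 1" "increasing (m - 1)" \<beta>1 \<beta>2] p \<open>increasing (m - 1) \<noteq> []\<close>
    by (simp add: increasing_1)
qed

lemma co_avoiding_involution_if_threads_decreasing: "threads (decreasing n) \<beta> \<Longrightarrow> co_avoiding_involution \<beta>"
proof (induction n arbitrary: \<beta> rule: less_induct)
  case (less n)
  from less.prems show ?case
  proof (cases rule: threads.cases)
    case one
    then show ?thesis using co_avoiding_involution_one by simp
  next
    case (frame \<alpha> \<beta>')
    have p: "is_perm \<alpha>" "is_perm \<beta>'" using threads_perm[OF frame(3)] by auto
    have "\<beta>' = increasing n" using frame(1) p by (metis complement_complement complement_decreasing)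
    then consider "\<alpha> = []" | \<gamma> where "\<alpha> = complement \<gamma>" "2 \<le> n" "threads (decreasing (n - 2)) \<gamma>"
      using threads_increasing[of \<alpha> n] frame by auto
    then show ?thesis
    proof cases
      case 1
      then show ?thesis using frame co_avoiding_involution_frame[OF co_avoiding_involution_Nil] by simp
    next
      case 2
      then have "co_avoiding_involution \<gamma>" using less.IH[of "n - 2"] by simp
      then show ?thesis using co_avoiding_involution_frame[of \<gamma>] 2 frame by (simp add: co_avoiding_involution_def)
    qed
  next
    case (skew \<alpha>1 \<beta>1 \<alpha>2 \<beta>2)
    have p: "is_perm \<alpha>1" "is_perm \<alpha>2" using threads_perm[OF skew(3)] threads_perm[OF skew(4)] by auto
    have "\<alpha>1 \<ominus>\<^sub>p [1] \<ominus>\<^sub>p \<alpha>2 = decreasing n" using skew(1) by simp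
    then have "\<alpha>1 = decreasing (length \<alpha>1)" "\<alpha>2 = decreasing (length \<alpha>2)" "n = length \<alpha>1 + 1 + length \<alpha>2"
      using p by (simp_all add: skew_eq_decreasing_iff)
    then have "co_avoiding_involution \<beta>1" "co_avoiding_involution \<beta>2"
      using less.IH[of "length \<alpha>1" \<beta>1] less.IH[of "length \<alpha>2" \<beta>2] skew by simp_all
    then show ?thesis using co_avoiding_involution_skew skew(2) by blast
  qed
qed

lemma threads_increasing_iff:
  assumes "0 < l"
  shows "threads \<alpha> (increasing l) \<longleftrightarrow> (\<exists>\<pi>. co_avoiding_involution \<pi> \<and> length \<pi> = l - 1 \<and> \<alpha> = complement \<pi>)"
proof
  assume "threads \<alpha> (increasing l)"
  then consider "\<alpha> = []" "l = 1" | \<beta> where "\<alpha> = complement \<beta>" "2 \<le> l" "threads (decreasing (l - 2)) \<beta>"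
    using threads_increasing by blast
  then show "\<exists>\<pi>. co_avoiding_involution \<pi> \<and> length \<pi> = l - 1 \<and> \<alpha> = complement \<pi>"
  proof cases
    case 1
    then show ?thesis using co_avoiding_involution_Nil by auto
  next
    case 2
    then show ?thesis using co_avoiding_involution_if_threads_decreasing[of "l - 2" \<beta>] threads_perm[of _ \<beta>]
      by (intro exI[of _ \<beta>]) force
  qed
next
  assume "\<exists>\<pi>. co_avoiding_involution \<pi> \<and> length \<pi> = l - 1 \<and> \<alpha> = complement \<pi>"
  then obtain \<pi> where \<pi>: "co_avoiding_involution \<pi>" "length \<pi> = l - 1" "\<alpha> = complement \<pi>" by blast
  show "threads \<alpha> (increasing l)"
  proof (cases "\<pi> = []")
    case True
    then have "l = 1" using \<pi> assms by simp
    then show ?thesis using True \<pi> threads.one by (simp add: increasing_1)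
  next
    case False
    then have "length \<pi> - 1 + 2 = l" using \<pi>(2) by (cases \<pi>) auto
    then show ?thesis using threads_decreasing_frame(1)[OF threads_co_avoiding_involution[OF \<pi>(1) False]] \<pi>(3) by simp
  qed
qed

lemma layered_simps [simp]: "layered [] = []" "layered (l # ls) = decreasing l \<oplus>\<^sub>p layered ls"
  by (simp_all add: layered_def)

lemma is_perm_layered [simp]: "is_perm (layered ls)"
  by (induction ls) auto

lemma layered_eq_Nil: "\<forall>l \<in> set ls. 0 < l \<Longrightarrow> layered ls = [] \<longleftrightarrow> ls = []"
  by (cases ls) (auto simp: decreasing_def)

lemma layered_two_not_skew:
  assumes "\<forall>l \<in> set ls. 0 < l" "2 \<le> length ls" "is_perm x" "is_perm y" "x \<noteq> []" "y \<noteq> []"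
  shows "layered ls \<noteq> x \<ominus>\<^sub>p y"
proof -
  obtain l l' ls' where ls: "ls = l # l' # ls'" using assms(2) by (cases ls; cases "tl ls") auto
  then have "0 < l" "0 < l'" using assms(1) by auto
  then have "decreasing l \<noteq> []" "layered (l' # ls') \<noteq> []" by (auto simp: decreasing_def)
  then show ?thesis
    using sum_neq_skew[of "decreasing l" "layered (l' # ls')" x y] assms(3-6) unfolding ls layered_simps(2)[of l]
    by simp
qed

text \<open>
  The first entry of a nonempty initial summand is \<open>l\<close>, the length of the first layer, so the
  summand contains this whole layer.
\<close>
lemma layered_eq_sum:
  assumes "\<forall>l \<in> set ls. 0 < l" "is_perm x" "is_perm y" "x \<oplus>\<^sub>p y = layered ls"
  shows "\<exists>ls1 ls2. ls = ls1 @ ls2 \<and> x = layered ls1 \<and> y = layered ls2"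
  using assms
proof (induction ls arbitrary: x)
  case Nil
  then show ?case by (intro exI[of _ "[]"]) simp
next
  case (Cons l ls)
  show ?case
  proof (cases "x = []")
    case True
    then show ?thesis using Cons.prems(4) by (intro exI[of _ "[]"] exI[of _ "l # ls"]) simp
  next
    case False
    have nth: "x ! i \<le> l" if "i < l" "i < length x" for i
    proof -
      have "x ! i = (x \<oplus>\<^sub>p y) ! i" using that by (simp add: sum_nth)
      also have "\<dots> = decreasing l ! i" using that Cons.prems(4) by (simp add: sum_nth)
      also have "\<dots> \<le> l" using is_perm_nth_bounds[of "decreasing l" i] that by simp
      finally show ?thesis .
    qed
    have "x ! 0 = (x \<oplus>\<^sub>p y) ! 0" using False by (simp add: sum_nth)
    also have "\<dots> = l" using Cons.prems(1,4) by (simp add: sum_nth decreasing_def rev_nth del: upt_Suc)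
    finally have "l \<le> length x" using is_perm_nth_bounds[OF Cons.prems(2), of 0] False by simp
    then obtain u v where uv: "is_perm u" "is_perm v" "length u = l" "x = u \<oplus>\<^sub>p v"
      using initial_block[OF Cons.prems(2), of l] nth by (metis order_less_le_trans)
    then have "u = decreasing l" "v \<oplus>\<^sub>p y = layered ls"
      using Cons.prems(4) sum_left_cancel[of u "decreasing l" "v \<oplus>\<^sub>p y" "layered ls"] by auto
    moreover obtain ls1 ls2 where "ls = ls1 @ ls2" "v = layered ls1" "y = layered ls2"
      using Cons.IH[OF _ uv(2) Cons.prems(3) calculation(2)] Cons.prems(1) by auto
    ultimately show ?thesis using uv(4) by (intro exI[of _ "l # ls1"] exI[of _ ls2]) simp
  qed
qed

lemma one_separated_append:
  "one_separated \<pi>s = x \<oplus>\<^sub>p [1] \<Longrightarrow> one_separated (\<pi>s @ \<pi>s') = x \<oplus>\<^sub>p one_separated \<pi>s'"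
proof (induction \<pi>s arbitrary: x)
  case Nil
  have "x = []" using arg_cong[OF Nil, of length] by simp
  then show ?case by simp
next
  case (Cons \<pi> \<pi>s)
  have "\<exists>z. one_separated \<pi>s = z \<oplus>\<^sub>p [1]" for \<pi>s
  proof (induction \<pi>s)
    case Nil
    then show ?case by (intro exI[of _ "[]"]) simp
  next
    case (Cons a \<pi>s)
    then obtain z where "one_separated \<pi>s = z \<oplus>\<^sub>p [1]" by blast
    then show ?case by (intro exI[of _ "[1] \<oplus>\<^sub>p a \<oplus>\<^sub>p z"]) simp
  qed
  then obtain z where z: "one_separated \<pi>s = z \<oplus>\<^sub>p [1]" by blast
  have eq: "([1] \<oplus>\<^sub>p \<pi> \<oplus>\<^sub>p z) \<oplus>\<^sub>p [1] = x \<oplus>\<^sub>p [1]" using Cons.prems z by simp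
  have "length ([1] \<oplus>\<^sub>p \<pi> \<oplus>\<^sub>p z) = length x" using arg_cong[OF eq, of length] by simp
  then have "x = [1] \<oplus>\<^sub>p \<pi> \<oplus>\<^sub>p z" using eq sum_left_cancel by blast
  then show ?case using Cons.IH[OF z] by simp
qed

lemma threads_complement_layered:
  assumes "ls \<noteq> []" "\<forall>l \<in> set ls. 0 < l" "list_all2 (\<lambda>l \<pi>. co_involution_3412 (l - 1) \<pi>) ls \<pi>s"
  shows "\<exists>\<alpha>. threads \<alpha> (complement (layered ls)) \<and> one_separated \<pi>s = [1] \<oplus>\<^sub>p complement \<alpha> \<oplus>\<^sub>p [1]"
  using assms
proof (induction ls arbitrary: \<pi>s)
  case (Cons l ls)
  then obtain p \<pi>s' where \<pi>s: "\<pi>s = p # \<pi>s'" "co_avoiding_involution p" "length p = l - 1"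
      "list_all2 (\<lambda>l \<pi>. co_involution_3412 (l - 1) \<pi>) ls \<pi>s'"
    by (auto simp: list_all2_Cons1 co_involution_3412_iff)
  have p: "threads (complement p) (increasing l)" "is_perm p"
    using \<pi>s Cons.prems(2) threads_increasing_iff[of l] by (auto simp: co_avoiding_involution_def)
  show ?case
  proof (cases "ls = []")
    case True
    then show ?thesis using p \<pi>s by (intro exI[of _ "complement p"]) simp
  next
    case False
    then obtain \<alpha> where \<alpha>: "threads \<alpha> (complement (layered ls))" "one_separated \<pi>s' = [1] \<oplus>\<^sub>p complement \<alpha> \<oplus>\<^sub>p [1]"
      using Cons.IH[OF False _ \<pi>s(4)] Cons.prems(2) by auto
    have "is_perm \<alpha>" using threads_perm[OF \<alpha>(1)] by simp
    then show ?thesis using threads.skew[OF p(1) \<alpha>(1)] p(2) \<pi>s(1) \<alpha>(2)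
      by (intro exI[of _ "complement p \<ominus>\<^sub>p [1] \<ominus>\<^sub>p \<alpha>"]) (simp add: complement_sum complement_skew)
  qed
qed simp

lemma threads_complement_layered_single:
  assumes "threads \<alpha> (complement (layered [l]))" "0 < l"
  shows "\<exists>\<pi>s. list_all2 (\<lambda>l \<pi>. co_involution_3412 (l - 1) \<pi>) [l] \<pi>s \<and>
    one_separated \<pi>s = [1] \<oplus>\<^sub>p complement \<alpha> \<oplus>\<^sub>p [1]"
proof -
  obtain \<pi> where "co_avoiding_involution \<pi>" "length \<pi> = l - 1" "\<alpha> = complement \<pi>"
    using assms threads_increasing_iff[of l \<alpha>] by auto
  then show ?thesis
    by (intro exI[of _ "[\<pi>]"]) (simp add: co_involution_3412_iff co_avoiding_involution_def)
qed

text \<open>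
  The odd thread is the skew sum of increasing permutations, so a frame can produce only a single
  summand, and a skew sum distributes the summands over its two parts.
\<close>
lemma separated_if_threads_complement_layered:
  "threads \<alpha> \<beta> \<Longrightarrow> \<forall>l \<in> set ls. 0 < l \<Longrightarrow> \<beta> = complement (layered ls) \<Longrightarrow>
    \<exists>\<pi>s. list_all2 (\<lambda>l \<pi>. co_involution_3412 (l - 1) \<pi>) ls \<pi>s \<and>
      one_separated \<pi>s = [1] \<oplus>\<^sub>p complement \<alpha> \<oplus>\<^sub>p [1]"
proof (induction arbitrary: ls rule: threads.induct)
  case one
  have "layered ls = [1]" using one by (metis complement_complement complement_small(2) is_perm_layered)
  then have "length (layered ls) = 1" "ls \<noteq> []" by auto
  then obtain l ls' where ls: "ls = l # ls'" "l + length (layered ls') = 1" by (cases ls) auto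
  then have "ls' = []" using one(1) layered_eq_Nil[of ls'] by (cases "layered ls'") auto
  then show ?case using threads_complement_layered_single[of "[]" l] threads.one one ls by simp
next
  case (frame \<alpha> \<beta>)
  have p: "is_perm \<alpha>" using threads_perm[OF frame.hyps] by simp
  have "layered ls = [1] \<ominus>\<^sub>p (\<alpha> \<ominus>\<^sub>p [1])"
    using arg_cong[OF frame.prems(2), of complement] p by (simp add: complement_sum)
  then have "\<not> 2 \<le> length ls" "length (layered ls) = length \<alpha> + 2"
    using layered_two_not_skew[OF frame.prems(1), of "[1]" "\<alpha> \<ominus>\<^sub>p [1]"] p by auto
  moreover from this have "ls \<noteq> []" by auto
  ultimately obtain l where "ls = [l]" by (cases ls) (auto simp: Suc_le_eq)
  then show ?case
    using threads_complement_layered_single[of "complement \<beta>" l] threads.frame[OF frame.hyps] frame.prems by simp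
next
  case (skew \<alpha> \<beta> \<alpha>' \<beta>')
  have p: "is_perm \<alpha>" "is_perm \<beta>" "is_perm \<alpha>'" "is_perm \<beta>'"
    using threads_perm[OF skew.hyps(1)] threads_perm[OF skew.hyps(2)] by auto
  have "complement \<beta> \<oplus>\<^sub>p complement \<beta>' = layered ls"
    using arg_cong[OF skew.prems(2), of complement] p by (simp add: complement_skew)
  then obtain ls1 ls2 where ls: "ls = ls1 @ ls2" "complement \<beta> = layered ls1" "complement \<beta>' = layered ls2"
    using layered_eq_sum[OF skew.prems(1), of "complement \<beta>" "complement \<beta>'"] p by auto
  have "\<beta> = complement (layered ls1)" "\<beta>' = complement (layered ls2)"
    using p ls(2,3)[symmetric] by simp_all
  then obtain \<pi>s1 \<pi>s2 where 1: "list_all2 (\<lambda>l \<pi>. co_involution_3412 (l - 1) \<pi>) ls1 \<pi>s1"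
      "one_separated \<pi>s1 = [1] \<oplus>\<^sub>p complement \<alpha> \<oplus>\<^sub>p [1]"
    and 2: "list_all2 (\<lambda>l \<pi>. co_involution_3412 (l - 1) \<pi>) ls2 \<pi>s2"
      "one_separated \<pi>s2 = [1] \<oplus>\<^sub>p complement \<alpha>' \<oplus>\<^sub>p [1]"
    using skew.IH(1)[of ls1] skew.IH(2)[of ls2] skew.prems(1) ls(1) by auto
  have "one_separated (\<pi>s1 @ \<pi>s2) = [1] \<oplus>\<^sub>p complement (\<alpha> \<ominus>\<^sub>p [1] \<ominus>\<^sub>p \<alpha>') \<oplus>\<^sub>p [1]"
    using one_separated_append[of \<pi>s1 "[1] \<oplus>\<^sub>p complement \<alpha>" \<pi>s2] 1 2 p by (simp add: complement_skew)
  then show ?case using 1(1) 2(1) ls(1) by (intro exI[of _ "\<pi>s1 @ \<pi>s2"]) (auto intro: list_all2_appendI)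
qed

lemma threads_layered_if_separated:
  assumes "ls \<noteq> []" "\<forall>l \<in> set ls. 0 < l" "Perm \<beta> \<in> separated_forms ls"
  shows "threads (layered ls) \<beta>"
proof -
  obtain \<pi>s where \<pi>s: "list_all2 (\<lambda>l \<pi>. co_involution_3412 (l - 1) \<pi>) ls \<pi>s" "\<beta> = one_separated \<pi>s"
    using assms(3) by (auto simp: separated_forms_def)
  then obtain \<alpha> where "threads \<alpha> (complement (layered ls))" "\<beta> = [1] \<oplus>\<^sub>p complement \<alpha> \<oplus>\<^sub>p [1]"
    using threads_complement_layered[OF assms(1,2)] by blast
  then show ?thesis using threads.frame[of \<alpha> "complement (layered ls)"] by simp
qed

text \<open>
  With at least two layers the even thread is a proper direct sum, which excludes the rule for skew
  sums. For a single layer of length one this fails, because \<open>\<emptyset> \<ominus> 1 \<ominus> \<emptyset>\<close> is layered.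
\<close>
lemma separated_if_threads_layered:
  assumes "2 \<le> length ls" "\<forall>l \<in> set ls. 0 < l" "threads (layered ls) \<beta>"
  shows "Perm \<beta> \<in> separated_forms ls"
  using assms(3)
proof (cases rule: threads.cases)
  case one
  then show ?thesis using layered_eq_Nil[OF assms(2)] assms(1) by auto
next
  case (frame \<alpha> \<beta>')
  have "\<beta>' = complement (layered ls)" using frame threads_perm[OF frame(3)] by simp
  then show ?thesis
    using separated_if_threads_complement_layered[OF frame(3) assms(2)] frame(2)
    by (auto simp: separated_forms_def) metis
next
  case (skew \<alpha>1 \<beta>1 \<alpha>2 \<beta>2)
  have p: "is_perm \<alpha>1" "is_perm \<alpha>2" using threads_perm[OF skew(3)] threads_perm[OF skew(4)] by auto
  note no = layered_two_not_skew[OF assms(2,1)]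
  have "\<alpha>1 = []" using no[of \<alpha>1 "[1] \<ominus>\<^sub>p \<alpha>2"] p skew(1) by auto
  moreover have "\<alpha>2 = []" using no[of "[1]" \<alpha>2] p skew(1) calculation by auto
  ultimately have one: "layered ls = [1]" using skew(1) by simp
  obtain l l' ls' where ls: "ls = l # l' # ls'" using assms(1) by (cases ls; cases "tl ls") auto
  then have "2 \<le> length (layered ls)" using assms(2) by auto
  then show ?thesis using one by simp
qed

lemma co_avoiding_involution_decreasing: "co_avoiding_involution (decreasing n)"
proof (induction n)
  case (Suc n)
  then show ?case using co_avoiding_involution_skew[OF co_avoiding_involution_one Suc] skew_decreasing[of 1 n] by (simp add: decreasing_1)
qed (simp add: co_avoiding_involution_Nil decreasing_1)

lemma separated_forms_nonempty: "\<exists>\<beta>. Perm \<beta> \<in> separated_forms ls"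
proof -
  have "list_all2 (\<lambda>l \<pi>. co_involution_3412 (l - 1) \<pi>) ls (map (\<lambda>l. decreasing (l - 1)) ls)"
    by (simp add: list_all2_conv_all_nth co_involution_3412_iff co_avoiding_involution_decreasing)
  then show ?thesis unfolding separated_forms_def by blast
qed



theorem theorem5p6:
  fixes ls :: "nat list"
  assumes "length ls \<ge> 1" and "\<forall>l \<in> set ls. l > 0"
  shows "even_thread (Perm (layered ls)) \<and>
         separated_forms ls \<subseteq> {\<beta>. entangled (Perm (layered ls)) \<beta>} \<and>
         (length ls \<ge> 2 \<longrightarrow>
            {\<beta>. entangled (Perm (layered ls)) \<beta>} = separated_forms ls)"
proof (intro conjI impI)
  have ne: "ls \<noteq> []" using assms(1) by auto
  show sub: "separated_forms ls \<subseteq> {\<beta>. entangled (Perm (layered ls)) \<beta>}"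
  proof
    fix \<beta> assume b: "\<beta> \<in> separated_forms ls"
    then obtain b where "\<beta> = Perm b" by (auto simp: separated_forms_def)
    then show "\<beta> \<in> {\<beta>. entangled (Perm (layered ls)) \<beta>}"
      using threads_layered_if_separated[OF ne assms(2)] b entangled_iff_threads by auto
  qed
  then show "even_thread (Perm (layered ls))"
    using separated_forms_nonempty[of ls] by (auto simp: entangled_def)
  assume two: "2 \<le> length ls"
  have "\<beta> \<in> separated_forms ls" if e: "entangled (Perm (layered ls)) \<beta>" for \<beta>
  proof -
    obtain \<pi> where "\<beta> = odd_part \<pi>" using e by (auto simp: entangled_def)
    then obtain b where "\<beta> = Perm b" by (cases \<pi>) auto
    then show ?thesis using separated_if_threads_layered[OF two assms(2)] e entangled_iff_threads by auto
  qed
  then show "{\<beta>. entangled (Perm (layered ls)) \<beta>} = separated_forms ls" using sub by auto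
qed

end
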